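(* Let $q_1,q_2$ be coprime positive integers, $Q=q_1q_2$, and let $V:\mathbb{Z}^2\to\mathbb{R}$ be $(q_1,q_2)$-periodic. For $m\in\{1,\dots,Q\}$ and $k\in[0,1)^2$ let $\lambda_m(k)$ be the $m$-th smallest eigenvalue of $D_V(k)$. Let $\lambda_*$ be an extremum (the maximum or the minimum value) of $\lambda_m(k)$ over $k\in[0,1)^2$. Then the level set $\{k\in[0,1)^2:\lambda_m(k)=\lambda_*\}$ has cardinality at most $9q_1q_2-3$.
   Context: $V$ is $(q_1,q_2)$-periodic if $V(n_1,n_2)=V(n_1+q_1,n_2)=V(n_1,n_2+q_2)$ for all $(n_1,n_2)\in\mathbb{Z}^2$. The operator $\Delta+V$ acts on $u:\mathbb{Z}^2\to\mathbb{C}$ by $((\Delta+V)u)(n)=u(n_1+1,n_2)+u(n_1-1,n_2)+u(n_1,n_2+1)+u(n_1,n_2-1)+V(n)u(n)$. For $k=(k_1,k_2)\in\mathbb{R}^2$, $D_V(k)$ is the $Q\times Q$ matrix of $\Delta+V$ acting on the space of functions $u$ satisfying the Floquet–Bloch conditions $u(n_1+q_1,n_2)=e^{2\pi i k_1}u(n)$ and $u(n_1,n_2+q_2)=e^{2\pi ik_2}u(n)$ for all $n\in\mathbb{Z}^2$, written in the coordinates $\{u(n_1,n_2):1\le n_1\le q_1,\ 1\le n_2\le q_2\}$; it is Hermitian since $V$ is real, so its eigenvalues are real and $\lambda_1(k)\le\dots\le\lambda_Q(k)$. *)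

theory Defs
  imports Complex_Main "Jordan_Normal_Form.Char_Poly"
begin

definition periodic2 :: "nat \<Rightarrow> nat \<Rightarrow> (int \<times> int \<Rightarrow> real) \<Rightarrow> bool" where
  "periodic2 q1 q2 V \<longleftrightarrow>
     (\<forall>n1 n2. V (n1, n2) = V (n1 + int q1, n2) \<and> V (n1, n2) = V (n1, n2 + int q2))"

text \<open>Coordinates: the basis index i < q1*q2 (0-based) corresponds to the
  lattice point (n1,n2) = (i mod q1 + 1, i div q1 + 1), 1 \<le> n1 \<le> q1, 1 \<le> n2 \<le> q2.\<close>
definition fb_pt :: "nat \<Rightarrow> nat \<Rightarrow> int \<times> int" where
  "fb_pt q1 i = (int (i mod q1) + 1, int (i div q1) + 1)"

definition fb_idx :: "nat \<Rightarrow> nat \<Rightarrow> int \<times> int \<Rightarrow> nat" where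
  "fb_idx q1 q2 n = nat ((fst n - 1) mod int q1) + q1 * nat ((snd n - 1) mod int q2)"

text \<open>Floquet-Bloch phase: u(n) = fb_phase * u(representative of n).\<close>
definition fb_phase :: "nat \<Rightarrow> nat \<Rightarrow> real \<times> real \<Rightarrow> int \<times> int \<Rightarrow> complex" where
  "fb_phase q1 q2 k n =
     cis (2 * pi * (fst k * of_int ((fst n - 1) div int q1) + snd k * of_int ((snd n - 1) div int q2)))"

text \<open>The Q x Q matrix D_V(k) of Delta + V on Floquet-Bloch functions.\<close>
definition D_V :: "nat \<Rightarrow> nat \<Rightarrow> (int \<times> int \<Rightarrow> real) \<Rightarrow> real \<times> real \<Rightarrow> complex mat" where
  "D_V q1 q2 V k = mat (q1 * q2) (q1 * q2) (\<lambda>(i, j).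
     (if i = j then complex_of_real (V (fb_pt q1 i)) else 0) +
     sum_list (map (\<lambda>n. if fb_idx q1 q2 n = j then fb_phase q1 q2 k n else 0)
       [(fst (fb_pt q1 i) + 1, snd (fb_pt q1 i)), (fst (fb_pt q1 i) - 1, snd (fb_pt q1 i)),
        (fst (fb_pt q1 i), snd (fb_pt q1 i) + 1), (fst (fb_pt q1 i), snd (fb_pt q1 i) - 1)]))"

text \<open>The m-th smallest eigenvalue (1-based, counted with algebraic multiplicity,
  i.e. as roots of the characteristic polynomial). D_V(k) is Hermitian, so these
  roots are real; we take real parts.\<close>
definition band :: "nat \<Rightarrow> nat \<Rightarrow> (int \<times> int \<Rightarrow> real) \<Rightarrow> nat \<Rightarrow> real \<times> real \<Rightarrow> real" where
  "band q1 q2 V m k =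
     sorted_list_of_multiset (image_mset Re (proots (char_poly (D_V q1 q2 V k)))) ! (m - 1)"

end

theory Submission
  imports Defs
    "HOL-Computational_Algebra.Fundamental_Theorem_Algebra"
    "HOL-Computational_Algebra.Field_as_Ring"
begin

text \<open>
  Put \<open>z = exp (2 \<pi> i k\<^sub>1)\<close> and \<open>w = exp (2 \<pi> i k\<^sub>2)\<close>. The determinant of \<open>D\<^sub>V(k) - \<lambda>\<^sub>*\<close> is a Laurent
  polynomial \<open>P(z, w)\<close> whose exponents satisfy \<open>q\<^sub>1|a| + q\<^sub>2|b| \<le> q\<^sub>1q\<^sub>2\<close>, because they are winding
  numbers of systems of closed walks with at most \<open>q\<^sub>1q\<^sub>2\<close> steps in total. Every point of the level
  set gives a double root of \<open>P(\<cdot>, w)\<close>: at a multiple eigenvalue the determinant vanishes to second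
  order in every direction, and at a simple one \<open>P\<close> is \<open>\<lambda>\<^sub>m - \<lambda>\<^sub>*\<close> times a factor of constant sign, so that
  \<open>P\<close> has a local extremum as well. Hence \<open>w\<close> is a zero of the resultant of \<open>f\<close> and \<open>\<partial>f/\<partial>z\<close>, where
  \<open>f\<close> is \<open>P\<close> cleared of negative exponents, and its multiplicity is at least the number of double roots
  above \<open>w\<close>. The resultant is the determinant of a matrix of size \<open>4q\<^sub>2 - 1\<close> with entries of degree at
  most \<open>2q\<^sub>1\<close> in \<open>w\<close>, so there are at most \<open>2q\<^sub>1(4q\<^sub>2 - 1) \<le> 9q\<^sub>1q\<^sub>2 - 3\<close> points, provided that it is not
  zero. As \<open>q\<^sub>1\<close> and \<open>q\<^sub>2\<close> are coprime, the only exponents on the boundary of the Newton polygon are its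
  vertices \<open>(\<plusminus>q\<^sub>2, 0)\<close>, \<open>(0, \<plusminus>q\<^sub>1)\<close>, so for large \<open>w\<close> the extreme monomials dominate and rule out double
  roots.
\<close>

section \<open>Resultants and double roots\<close>

text \<open>This is the Sylvester matrix, with coefficients in ascending order. The numbers
  \<open>m\<close> and \<open>n\<close> are formal degrees, independent of the actual ones, so that
  the matrix commutes with specialisation of the coefficients even when a degree drops.\<close>

definition sylv :: "nat \<Rightarrow> nat \<Rightarrow> 'a::comm_ring_1 poly \<Rightarrow> 'a poly \<Rightarrow> 'a mat" where
  "sylv m n f g = mat (m + n) (m + n)
     (\<lambda>(i, j). if i < n then coeff (monom 1 i * f) j else coeff (monom 1 (i - n) * g) j)"

lemma sylv_carrier [simp]: "sylv m n f g \<in> carrier_mat (m + n) (m + n)"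
  by (simp add: sylv_def)

lemma poly_eq_sum_lessThan:
  fixes p :: "'a::comm_semiring_1 poly"
  assumes "degree p < N"
  shows "poly p x = (\<Sum>l<N. coeff p l * x ^ l)"
proof -
  have "poly p x = (\<Sum>l\<le>degree p. coeff p l * x ^ l)"
    by (rule poly_altdef)
  also have "\<dots> = (\<Sum>l<N. coeff p l * x ^ l)"
    using assms by (intro sum.mono_neutral_left) (auto simp: coeff_eq_0)
  finally show ?thesis .
qed

lemma coeff_sum_monom_lessThan:
  "coeff (\<Sum>i<n. monom (c i) i) k = (if k < n then c k else (0::'a::comm_monoid_add))"
  by (simp add: coeff_sum)

lemma degree_sum_monom_lessThan:
  assumes "0 < n"
  shows "degree (\<Sum>i<n. monom (c i) i) < n"
proof -
  have "degree (\<Sum>i<n. monom (c i) i) \<le> n - 1"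
    using assms by (intro degree_le) (auto simp: coeff_sum_monom_lessThan)
  thus ?thesis using assms by simp
qed

lemma sum_lessThan_add:
  "(\<Sum>i<n + m. F i) = (\<Sum>i<n. F i) + (\<Sum>i<m. F (n + i))"
  for F :: "nat \<Rightarrow> 'a::comm_monoid_add"
  by (induction m) (auto simp: add.assoc)

text \<open>A kernel vector would be the coefficient vector of a nonzero polynomial of degree less
  than \<open>N\<close> with \<open>N\<close> distinct roots.\<close>

lemma det_vandermonde_nonzero:
  fixes \<zeta> :: "nat \<Rightarrow> 'a::field"
  assumes inj: "inj_on \<zeta> {..<N}"
  shows "det (mat N N (\<lambda>(i, l). \<zeta> i ^ l)) \<noteq> 0"
proof
  let ?A = "mat N N (\<lambda>(i, l). \<zeta> i ^ l)"
  have A: "?A \<in> carrier_mat N N" by simp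
  assume "det ?A = 0"
  then obtain v where v: "v \<in> carrier_vec N" "v \<noteq> 0\<^sub>v N" "?A *\<^sub>v v = 0\<^sub>v N"
    using det_0_iff_vec_prod_zero_field[OF A] by blast
  define p where "p = (\<Sum>i<N. monom (v $ i) i)"
  have N: "N > 0" using v by (cases N) auto
  have deg: "degree p < N" unfolding p_def using degree_sum_monom_lessThan[OF N] .
  have cp: "coeff p l = v $ l" if "l < N" for l
    using that by (simp add: p_def coeff_sum_monom_lessThan)
  have "poly p (\<zeta> i) = 0" if "i < N" for i
  proof -
    have "0 = (?A *\<^sub>v v) $ i" using v that by simp
    also have "\<dots> = (\<Sum>l<N. \<zeta> i ^ l * v $ l)"
      using that v(1) by (simp add: scalar_prod_def atLeast0LessThan)
    also have "\<dots> = poly p (\<zeta> i)"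
      by (subst poly_eq_sum_lessThan[OF deg]) (simp add: cp mult.commute)
    finally show ?thesis by simp
  qed
  hence sub: "\<zeta> ` {..<N} \<subseteq> {x. poly p x = 0}" by auto
  have "p = 0"
  proof (rule ccontr)
    assume p0: "p \<noteq> 0"
    have "N = card (\<zeta> ` {..<N})" using inj by (simp add: card_image)
    also have "\<dots> \<le> card {x. poly p x = 0}"
      by (rule card_mono[OF poly_roots_finite[OF p0] sub])
    also have "\<dots> \<le> degree p" by (rule card_poly_roots_bound[OF p0])
    finally show False using deg by simp
  qed
  hence "v = 0\<^sub>v N" using v(1) cp by (intro eq_vecI) auto
  with v(2) show False by simp
qed

text \<open>Every term of the Leibniz expansion contains exactly one entry from each of the first
  \<open>s\<close> rows, hence \<open>s\<close> factors divisible by \<open>d\<close>.\<close>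

lemma power_dvd_det_rows:
  fixes A :: "'a::comm_ring_1 mat"
  assumes A: "A \<in> carrier_mat N N" and s: "s \<le> N"
    and d: "\<And>i j. i < s \<Longrightarrow> j < N \<Longrightarrow> d dvd A $$ (i, j)"
  shows "d ^ s dvd det A"
  unfolding det_def'[OF A]
proof (intro dvd_sum dvd_mult)
  fix p assume "p \<in> {p. p permutes {0..<N}}"
  hence p: "p permutes {0..<N}" by simp
  have "d ^ s = (\<Prod>i<s. d)" by simp
  also have "\<dots> dvd (\<Prod>i<s. A $$ (i, p i))"
    using s permutes_in_image[OF p] by (intro prod_dvd_prod d) (auto simp: less_le_trans)
  also have "\<dots> dvd (\<Prod>i=0..<N. A $$ (i, p i))"
    using s by (intro prod_dvd_prod_subset) auto
  finally show "d ^ s dvd (\<Prod>i=0..<N. A $$ (i, p i))" .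
qed

text \<open>Multiplying by the Vandermonde matrix of the common roots, completed to distinct nodes,
  produces one row divisible by \<open>w - w\<^sub>0\<close> for every common root.\<close>

lemma det_sylv_common_roots_dvd:
  fixes f g :: "complex poly poly"
  assumes df: "degree f \<le> m" and dg: "degree g \<le> n" and n: "0 < n" and m: "0 < m"
    and fin: "finite S" and card: "card S \<le> m + n"
    and root: "\<And>z. z \<in> S \<Longrightarrow> poly (poly f [:z:]) w0 = 0 \<and> poly (poly g [:z:]) w0 = 0"
  shows "[:-w0, 1:] ^ card S dvd det (sylv m n f g)"
proof -
  let ?N = "m + n" and ?s = "card S"
  obtain S' where S': "finite S'" "card S' = ?N - ?s" "S' \<inter> S = {}"
  proof -
    have "infinite (UNIV - S)" using fin infinite_UNIV_char_0[where 'a = complex] by simp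
    then obtain B where "B \<subseteq> UNIV - S" "finite B" "card B = ?N - ?s"
      using infinite_arbitrarily_large by blast
    thus ?thesis using that by blast
  qed
  obtain h where h: "bij_betw h {0..<?s} S" using ex_bij_betw_nat_finite[OF fin] by blast
  obtain h' where h': "bij_betw h' {0..<?N - ?s} S'"
    using ex_bij_betw_nat_finite[OF S'(1)] S'(2) by auto
  define \<zeta> where "\<zeta> i = (if i < ?s then h i else h' (i - ?s))" for i
  have hS: "h i \<in> S" if "i < ?s" for i using h that by (auto simp: bij_betw_def)
  have hS': "h' i \<in> S'" if "i < ?N - ?s" for i using h' that by (auto simp: bij_betw_def)
  have hi: "h i = h j \<longleftrightarrow> i = j" if "i < ?s" "j < ?s" for i j
    using h that by (auto simp: bij_betw_def inj_on_def)
  have hi': "h' i = h' j \<longleftrightarrow> i = j" if "i < ?N - ?s" "j < ?N - ?s" for i j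
    using h' that by (auto simp: bij_betw_def inj_on_def)
  have inj: "inj_on \<zeta> {..<?N}"
  proof (rule inj_onI)
    fix i j assume ij: "i \<in> {..<?N}" "j \<in> {..<?N}" and e: "\<zeta> i = \<zeta> j"
    have inS: "\<zeta> i \<in> S \<longleftrightarrow> i < ?s" if "i < ?N" for i
      using hS[of i] hS'[of "i - ?s"] S'(3) that
      by (cases "i < ?s") (simp_all add: \<zeta>_def disjoint_iff diff_less_mono)
    have c: "i < ?s \<longleftrightarrow> j < ?s" using e inS ij by (metis lessThan_iff)
    show "i = j"
    proof (cases "i < ?s")
      case True
      thus ?thesis using e c hi[of i j] by (simp add: \<zeta>_def)
    next
      case False
      hence "i - ?s = j - ?s" using e c ij hi'[of "i - ?s" "j - ?s"] by (simp add: \<zeta>_def)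
      thus ?thesis using False c by simp
    qed
  qed
  define W where "W = mat ?N ?N (\<lambda>(i, l). \<zeta> i ^ l)"
  \<comment> \<open>The entries of the Sylvester matrix are polynomials in \<open>w\<close>, so the
    Vandermonde matrix has to be lifted to constant polynomials before multiplying.\<close>
  define W' where "W' = map_mat (\<lambda>c. [:c:]) W"
  let ?A = "sylv m n f g"
  have Wc: "W' \<in> carrier_mat ?N ?N" by (simp add: W'_def W_def)
  interpret c: comm_ring_hom "\<lambda>c::complex. [:c:]" by unfold_locales (simp_all add: one_pCons)
  have detW: "det W' = [:det W:]" using c.hom_det[of W] by (simp only: W'_def)
  have ev: "(W' * transpose_mat ?A) $$ (i, j) =
      poly (if j < n then monom 1 j * f else monom 1 (j - n) * g) [:\<zeta> i:]"
    if ij: "i < ?N" "j < ?N" for i j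
  proof -
    have row: "?A $$ (j, l) = coeff (if j < n then monom 1 j * f else monom 1 (j - n) * g) l"
      if "l < ?N" for l using ij that by (simp add: sylv_def)
    have deg: "degree (if j < n then monom 1 j * f else monom 1 (j - n) * g) < ?N"
    proof (cases "j < n")
      case True
      have "degree (monom 1 j * f) \<le> j + m"
        using degree_mult_le[of "monom 1 j" f] degree_monom_le[of "1::complex poly" j] df by linarith
      thus ?thesis using True by simp
    next
      case False
      have "degree (monom 1 (j - n) * g) \<le> (j - n) + n"
        using degree_mult_le[of "monom 1 (j - n)" g] degree_monom_le[of "1::complex poly" "j - n"] dg
        by linarith
      thus ?thesis using False ij by simp
    qed
    have "(W' * transpose_mat ?A) $$ (i, j) = (\<Sum>l<?N. W' $$ (i, l) * ?A $$ (j, l))"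
      using ij by (simp add: scalar_prod_def W'_def W_def sylv_def atLeast0LessThan)
    also have "\<dots> = (\<Sum>l<?N. ?A $$ (j, l) * [:\<zeta> i:] ^ l)"
      using ij by (intro sum.cong) (auto simp: W'_def W_def poly_const_pow mult.commute)
    also have "\<dots> = poly (if j < n then monom 1 j * f else monom 1 (j - n) * g) [:\<zeta> i:]"
      by (subst poly_eq_sum_lessThan[OF deg]) (simp add: row)
    finally show ?thesis .
  qed
  have "[:-w0, 1:] ^ ?s dvd det (W' * transpose_mat ?A)"
  proof (rule power_dvd_det_rows)
    show "W' * transpose_mat ?A \<in> carrier_mat ?N ?N"
      by (rule mult_carrier_mat[OF Wc]) (simp add: sylv_def)
    show "?s \<le> ?N" by (rule card)
    fix i j assume i: "i < ?s" and j: "j < ?N"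
    have "\<zeta> i \<in> S" using hS[OF i] i by (simp add: \<zeta>_def)
    hence r: "poly (poly f [:\<zeta> i:]) w0 = 0" "poly (poly g [:\<zeta> i:]) w0 = 0" using root by auto
    have "poly ((W' * transpose_mat ?A) $$ (i, j)) w0 = 0"
      using r i card j by (subst ev) (auto simp: poly_mult)
    thus "[:-w0, 1:] dvd (W' * transpose_mat ?A) $$ (i, j)" by (simp add: poly_eq_0_iff_dvd)
  qed
  \<comment> \<open>The Vandermonde determinant is a nonzero constant, so it does not affect
    divisibility and can be removed.\<close>
  also have "det (W' * transpose_mat ?A) = det W' * det ?A"
    by (subst det_mult[OF Wc]) (simp_all add: det_transpose[OF sylv_carrier])
  also have "\<dots> = Polynomial.smult (det W) (det ?A)" by (simp add: detW)
  finally show ?thesis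
    using det_vandermonde_nonzero[OF inj] by (simp add: W_def dvd_smult_iff)
qed

text \<open>A kernel vector of the transpose encodes a relation \<open>U * f + W * g = 0\<close>
  with \<open>degree U < n\<close> and \<open>degree W < m\<close>. Without a common root
  \<open>f\<close> and \<open>g\<close> are coprime, so \<open>f\<close> divides \<open>W\<close>;
  since \<open>f\<close> has degree exactly \<open>m\<close>, this forces \<open>W = 0\<close> and
  then \<open>U = 0\<close>.\<close>

lemma det_sylv_nonzero:
  fixes f g :: "complex poly"
  assumes df: "degree f = m" and dg: "degree g \<le> n" and n: "0 < n" and m: "0 < m"
    and nr: "\<And>z. \<not> (poly f z = 0 \<and> poly g z = 0)"
  shows "det (sylv m n f g) \<noteq> 0"
proof
  let ?A = "sylv m n f g" and ?N = "m + n"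
  assume "det ?A = 0"
  hence "det (transpose_mat ?A) = 0" by (simp add: det_transpose[OF sylv_carrier])
  then obtain v where v: "v \<in> carrier_vec ?N" "v \<noteq> 0\<^sub>v ?N" "transpose_mat ?A *\<^sub>v v = 0\<^sub>v ?N"
    using det_0_iff_vec_prod_zero_field[of "transpose_mat ?A" ?N] by (auto simp: sylv_def)
  define U where "U = (\<Sum>i<n. monom (v $ i) i)"
  define W where "W = (\<Sum>i<m. monom (v $ (n + i)) i)"
  have dU: "degree U < n" unfolding U_def by (rule degree_sum_monom_lessThan[OF n])
  have dW: "degree W < m" unfolding W_def by (rule degree_sum_monom_lessThan[OF m])
  have f0: "f \<noteq> 0" using df m by auto
  have cUW: "coeff (U * f + W * g) j = 0" for j
  proof (cases "j < ?N")
    case True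
    have "0 = (transpose_mat ?A *\<^sub>v v) $ j" using v(3) True by simp
    also have "\<dots> = (\<Sum>i<?N. ?A $$ (i, j) * v $ i)"
      using True v(1) by (simp add: scalar_prod_def sylv_def atLeast0LessThan)
    also have "\<dots> = (\<Sum>i<n. ?A $$ (i, j) * v $ i) + (\<Sum>i<m. ?A $$ (n + i, j) * v $ (n + i))"
      by (subst add.commute[of m n]) (rule sum_lessThan_add)
    also have "\<dots> = (\<Sum>i<n. coeff (monom (v $ i) i * f) j) + (\<Sum>i<m. coeff (monom (v $ (n + i)) i * g) j)"
    proof -
      have e: "coeff (monom 1 i * p) j * c = coeff (monom c i * p) j" for i c and p :: "complex poly"
        by (metis coeff_smult mult.commute mult.right_neutral mult_smult_left smult_monom)
      show ?thesis
        using True by (simp add: sylv_def e)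
    qed
    also have "\<dots> = coeff (U * f + W * g) j"
      by (simp add: U_def W_def sum_distrib_right coeff_sum)
    finally show ?thesis by simp
  next
    case False
    have "degree (U * f + W * g) < ?N"
    proof (rule degree_add_less)
      show "degree (U * f) < ?N" using degree_mult_le[of U f] dU df by linarith
      show "degree (W * g) < ?N" using degree_mult_le[of W g] dW dg by linarith
    qed
    thus ?thesis using False by (intro coeff_eq_0) linarith
  qed
  hence UW: "U * f + W * g = 0" by (intro poly_eqI) simp
  have "W * g = f * (- U)" using UW by (simp add: eq_neg_iff_add_eq_0 add.commute mult.commute)
  hence "f dvd W * g" by (rule dvdI)
  moreover have "coprime f g"
  proof (rule ccontr)
    assume "\<not> coprime f g"
    hence "\<not> is_unit (gcd f g)" using is_unit_gcd[of f g] by blast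
    hence "degree (gcd f g) \<noteq> 0" using f0 is_unit_iff_degree[of "gcd f g"] by fastforce
    hence "\<not> constant (poly (gcd f g))" by (simp add: constant_degree)
    then obtain z where "poly (gcd f g) z = 0"
      using fundamental_theorem_of_algebra by blast
    hence "[:-z, 1:] dvd gcd f g" by (simp add: poly_eq_0_iff_dvd)
    hence "[:-z, 1:] dvd f" "[:-z, 1:] dvd g" by auto
    thus False using nr[of z] by (simp add: poly_eq_0_iff_dvd)
  qed
  ultimately have "f dvd W" using coprime_dvd_mult_left_iff[of f g W] by simp
  hence W0: "W = 0" using dvd_imp_degree_le[of f W] dW df by (cases "W = 0") auto
  with UW f0 have U0: "U = 0" by simp
  have "v $ i = 0" if "i < ?N" for i
  proof (cases "i < n")
    case True
    thus ?thesis using U0 coeff_sum_monom_lessThan[of "\<lambda>i. v $ i" n i] by (simp add: U_def)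
  next
    case False
    hence "i - n < m" "n + (i - n) = i" using that by auto
    thus ?thesis using W0 coeff_sum_monom_lessThan[of "\<lambda>i. v $ (n + i)" m "i - n"]
      by (simp add: W_def)
  qed
  hence "v = 0\<^sub>v ?N" using v(1) by (intro eq_vecI) auto
  with v(2) show False by simp
qed

text \<open>In a bivariate polynomial the outer variable is \<open>z\<close> and the coefficients
  are polynomials in \<open>w\<close>. Fixing \<open>w\<close> leaves the fibre polynomial in
  \<open>z\<close>.\<close>

abbreviation eval_coeffs :: "'a::comm_semiring_0 \<Rightarrow> 'a poly poly \<Rightarrow> 'a poly" where
  "eval_coeffs w f \<equiv> map_poly (\<lambda>p. poly p w) f"

lemma poly_eval_coeffs: "poly (eval_coeffs w f) z = poly (poly f [:z:]) w"
  by (induction f) (auto simp: map_poly_pCons)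

lemma pderiv_eval_coeffs: "pderiv (eval_coeffs w f) = eval_coeffs w (pderiv f)"
  for f :: "complex poly poly"
  by (intro poly_eqI) (simp add: coeff_pderiv coeff_map_poly)

lemma poly_det_sylv:
  fixes f g :: "complex poly poly"
  shows "poly (det (sylv m n f g)) w = det (sylv m n (eval_coeffs w f) (eval_coeffs w g))"
proof -
  have hom: "comm_ring_hom (\<lambda>p::complex poly. poly p w)" by unfold_locales auto
  have "map_mat (\<lambda>p. poly p w) (sylv m n f g) = sylv m n (eval_coeffs w f) (eval_coeffs w g)"
    by (rule eq_matI) (auto simp: sylv_def coeff_monom_mult coeff_map_poly)
  thus ?thesis using comm_ring_hom.hom_det[OF hom, of "sylv m n f g"] by simp
qed

text \<open>The resultant with respect to \<open>z\<close> has degree at most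
  \<open>d * (2 * m - 1)\<close> in \<open>w\<close>, and its order at each \<open>w\<close> bounds
  the number of double roots in that fibre, so the count is a sum of orders. The sample fibre at
  \<open>w1\<close> certifies that the resultant is not zero. Where the leading coefficient
  survives, the fibre has degree \<open>m\<close>, hence is nonzero with finitely many
  roots.\<close>

lemma card_double_roots_le:
  fixes f :: "complex poly poly"
  defines "S \<equiv> \<lambda>w. {z. poly (eval_coeffs w f) z = 0 \<and> poly (pderiv (eval_coeffs w f)) z = 0}"
  assumes deg: "degree f = m" and m: "2 \<le> m" and d: "\<And>j. degree (coeff f j) \<le> d"
    and w1: "poly (coeff f m) w1 \<noteq> 0" "S w1 = {}"
  shows "finite {(z, w). poly (coeff f m) w \<noteq> 0 \<and> z \<in> S w} \<and>
    card {(z, w). poly (coeff f m) w \<noteq> 0 \<and> z \<in> S w} \<le> d * (2 * m - 1)"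
proof -
  let ?n = "m - 1" and ?T = "{(z, w). poly (coeff f m) w \<noteq> 0 \<and> z \<in> S w}"
  define R where "R = det (sylv m ?n f (pderiv f))"
  have degev: "degree (eval_coeffs w f) = m" if "poly (coeff f m) w \<noteq> 0" for w
    using that deg by (intro antisym degree_le le_degree)
      (auto simp: coeff_map_poly coeff_eq_0)
  have "degree R \<le> d * (m + ?n)"
    unfolding R_def
  proof (rule degree_det_le[OF _ sylv_carrier])
    fix i j assume ij: "i < m + ?n" "j < m + ?n"
    have "degree (coeff (pderiv f) k) \<le> d" for k
    proof -
      have "coeff (pderiv f) k = Polynomial.smult (of_nat (Suc k)) (coeff f (Suc k))"
        by (simp add: coeff_pderiv of_nat_poly)
      thus ?thesis using d[of "Suc k"] by (simp add: degree_smult_eq)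
    qed
    thus "degree (sylv m ?n f (pderiv f) $$ (i, j)) \<le> d"
      using ij d by (auto simp: sylv_def coeff_monom_mult)
  qed
  also have "m + ?n = 2 * m - 1" using m by simp
  finally have dR: "degree R \<le> d * (2 * m - 1)" .
  have "poly R w1 \<noteq> 0"
    unfolding R_def poly_det_sylv
  proof (rule det_sylv_nonzero)
    show "degree (eval_coeffs w1 f) = m" by (rule degev[OF w1(1)])
    thus "degree (eval_coeffs w1 (pderiv f)) \<le> ?n"
      by (simp flip: pderiv_eval_coeffs add: degree_pderiv)
    show "0 < ?n" "0 < m" using m by auto
    fix z show "\<not> (poly (eval_coeffs w1 f) z = 0 \<and> poly (eval_coeffs w1 (pderiv f)) z = 0)"
      using w1(2) by (auto simp: S_def pderiv_eval_coeffs)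
  qed
  hence R0: "R \<noteq> 0" by auto
  have fins: "finite (S w) \<and> card (S w) \<le> order w R" if w: "poly (coeff f m) w \<noteq> 0" for w
  proof -
    have f0: "eval_coeffs w f \<noteq> 0" using degev[OF w] m by auto
    have sub: "S w \<subseteq> {z. poly (eval_coeffs w f) z = 0}" by (auto simp: S_def)
    have fin: "finite (S w)" by (rule finite_subset[OF sub poly_roots_finite[OF f0]])
    have "card (S w) \<le> card {z. poly (eval_coeffs w f) z = 0}"
      by (rule card_mono[OF poly_roots_finite[OF f0] sub])
    also have "\<dots> \<le> m" using card_poly_roots_bound[OF f0] degev[OF w] by simp
    finally have c: "card (S w) \<le> m" .
    have "[:-w, 1:] ^ card (S w) dvd R"
      unfolding R_def
    proof (rule det_sylv_common_roots_dvd)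
      show "degree f \<le> m" "degree (pderiv f) \<le> ?n" by (simp_all add: deg degree_pderiv)
      show "0 < ?n" "0 < m" "card (S w) \<le> m + ?n" using m c by auto
      show "finite (S w)" by (rule fin)
      fix z assume "z \<in> S w"
      thus "poly (poly f [:z:]) w = 0 \<and> poly (poly (pderiv f) [:z:]) w = 0"
        by (simp add: S_def pderiv_eval_coeffs flip: poly_eval_coeffs)
    qed
    with R0 fin show ?thesis by (simp add: order_divides)
  qed
  define W where "W = {w. poly (coeff f m) w \<noteq> 0 \<and> S w \<noteq> {}}"
  have "W \<subseteq> {w. poly R w = 0}"
  proof
    fix w assume "w \<in> W"
    hence w: "poly (coeff f m) w \<noteq> 0" "S w \<noteq> {}" by (auto simp: W_def)
    hence "card (S w) > 0" using fins[OF w(1)] by (simp add: card_gt_0_iff)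
    hence "order w R \<noteq> 0" using fins[OF w(1)] by linarith
    thus "w \<in> {w. poly R w = 0}" by (simp add: order_root)
  qed
  hence finW: "finite W" by (rule finite_subset[OF _ poly_roots_finite[OF R0]])
  have T: "?T = (\<lambda>(w, z). (z, w)) ` Sigma W S" by (force simp: W_def image_iff)
  have finS: "finite (Sigma W S)" using finW fins by (intro finite_SigmaI) (auto simp: W_def)
  have "card ?T \<le> card (Sigma W S)" unfolding T by (rule card_image_le[OF finS])
  also have "\<dots> = (\<Sum>w\<in>W. card (S w))"
    using finW fins by (intro card_SigmaI) (auto simp: W_def)
  also have "\<dots> \<le> (\<Sum>w\<in>W. order w R)" using fins by (intro sum_mono) (auto simp: W_def)
  also have "\<dots> \<le> (\<Sum>w | poly R w = 0. order w R)"
    by (rule sum_mono2[OF poly_roots_finite[OF R0] \<open>W \<subseteq> _\<close>]) auto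
  also have "\<dots> \<le> degree R" by (rule sum_order_le_degree[OF R0])
  finally show ?thesis using dR finS unfolding T by auto
qed

section \<open>Newton polygon with three extreme monomials\<close>

text \<open>Outside a bounded region the three extreme monomials cannot cancel in a Laurent polynomial
  and in its logarithmic \<open>z\<close>-derivative at once: here \<open>u\<close>, \<open>v\<close>, \<open>x\<close> stand for the extreme
  monomials and \<open>P\<close> bounds the others.\<close>

lemma extreme_monomials_bound:
  fixes \<alpha> \<beta> \<gamma> u v x E0 E1 :: complex and M P c :: real
  assumes \<alpha>: "\<alpha> \<noteq> 0" and \<gamma>: "\<gamma> \<noteq> 0" and c: "1 \<le> c" and P: "0 \<le> P" and M: "0 \<le> M"
    and e0: "\<alpha> * u + \<beta> * v + \<gamma> * x + E0 = 0"
    and e1: "of_real c * (\<alpha> * u - \<beta> * v) + E1 = 0"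
    and v: "norm v \<le> P" and E0: "norm E0 \<le> M * P" and E1: "norm E1 \<le> M * P"
  shows "norm u \<le> (norm \<beta> + M) / norm \<alpha> * P \<and> norm x \<le> 2 * (norm \<beta> + M) / norm \<gamma> * P"
proof
  have bv: "norm (\<beta> * v) \<le> norm \<beta> * P" using v by (simp add: norm_mult mult_left_mono)
  have c0: "(of_real c :: complex) \<noteq> 0" using c by simp
  have "\<alpha> * u = \<beta> * v - E1 / of_real c" using e1 c0
    by (simp add: field_simps)
  hence "norm (\<alpha> * u) \<le> norm (\<beta> * v) + norm (E1 / of_real c)" by (simp add: norm_triangle_ineq4)
  also have "norm (E1 / of_real c) \<le> norm E1"
    using c by (simp add: norm_divide divide_le_eq mult_le_cancel_left1 zero_le_mult_iff)
  finally have au: "norm (\<alpha> * u) \<le> (norm \<beta> + M) * P" using bv E1 by (simp add: algebra_simps)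
  thus "norm u \<le> (norm \<beta> + M) / norm \<alpha> * P" using \<alpha> by (simp add: norm_mult field_simps)
  have "\<gamma> * x = - (\<alpha> * u + \<beta> * v + E0)" using e0 by (simp add: eq_neg_iff_add_eq_0 algebra_simps)
  hence "norm (\<gamma> * x) \<le> norm (\<alpha> * u) + norm (\<beta> * v) + norm E0"
    by (metis norm_minus_cancel norm_triangle_ineq norm_triangle_mono order_refl)
  hence "norm (\<gamma> * x) \<le> 2 * (norm \<beta> + M) * P" using au bv E0 by (simp add: algebra_simps)
  thus "norm x \<le> 2 * (norm \<beta> + M) / norm \<gamma> * P" using \<gamma> by (simp add: norm_mult field_simps)
qed

lemma norm_power_int_le:
  fixes z :: complex
  assumes "z \<noteq> 0" "norm z \<le> r" "1 / norm z \<le> r"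
  shows "norm (z powi a) \<le> r ^ nat \<bar>a\<bar>"
proof (cases "a \<ge> 0")
  case True
  thus ?thesis using assms by (simp add: power_int_def norm_power power_mono)
next
  case False
  have "norm (z powi a) = (1 / norm z) ^ nat (- a)"
    using False by (simp add: power_int_def norm_power norm_divide inverse_eq_divide)
  also have "\<dots> \<le> r ^ nat (- a)" using assms by (intro power_mono) auto
  finally show ?thesis using False by simp
qed

text \<open>Measure \<open>z\<close> on the scale \<open>\<rho> ^ q1\<close> and \<open>w\<close> on
  the scale \<open>\<rho> ^ q2\<close>. Monomials strictly inside the Newton polygon are then at
  most \<open>\<rho> ^ (q1 * q2 - 1)\<close>, whereas one of the three vertex monomials has size
  exactly \<open>\<rho> ^ (q1 * q2)\<close>. The fourth vertex \<open>(0, - q1)\<close> is harmless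
  because \<open>w\<close> is large. The index set is abstract so that several terms may share the
  same exponents.\<close>

lemma no_double_root_for_large_w:
  fixes C :: "'i \<Rightarrow> complex" and a b :: "'i \<Rightarrow> int" and q1 q2 :: nat
  assumes fin: "finite I" and q: "0 < q1" "0 < q2"
    and ends: "i1 \<in> I" "i2 \<in> I" "i3 \<in> I" "C i1 \<noteq> 0" "C i2 \<noteq> 0" "C i3 \<noteq> 0"
      "a i1 = int q2" "b i1 = 0" "a i2 = - int q2" "b i2 = 0" "a i3 = 0" "b i3 = int q1"
    and supp: "\<And>i. i \<in> I - {i1, i2, i3} \<Longrightarrow> C i \<noteq> 0 \<Longrightarrow>
      \<bar>a i\<bar> * int q1 + \<bar>b i\<bar> * int q2 < int q1 * int q2 \<or> a i = 0 \<and> b i = - int q1"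
  shows "\<exists>w. w \<noteq> 0 \<and> (\<forall>z. z \<noteq> 0 \<longrightarrow> \<not> ((\<Sum>i\<in>I. C i * z powi a i * w powi b i) = 0 \<and>
    (\<Sum>i\<in>I. of_int (a i) * (C i * z powi a i * w powi b i)) = 0))"
proof -
  let ?Q = "q1 * q2"
  define M where "M = (\<Sum>i\<in>I. norm (C i) * (1 + \<bar>of_int (a i)\<bar>))"
  \<comment> \<open>These are the constants that \<open>extreme_monomials_bound\<close> yields for
    the two assignments of \<open>z ^ q2\<close> and its inverse to the roles of \<open>u\<close>
    and \<open>v\<close>.\<close>
  define K where "K = Max {(norm (C i2) + M) / norm (C i1), (norm (C i1) + M) / norm (C i2),
    2 * (norm (C i2) + M) / norm (C i3), 2 * (norm (C i1) + M) / norm (C i3)}"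
  have M0: "0 \<le> M" unfolding M_def by (intro sum_nonneg) simp
  define T where "T = max K 0 + 1"
  have T: "1 \<le> T" "K < T" by (auto simp: T_def)
  \<comment> \<open>With this choice \<open>w ^ q1\<close> has norm \<open>T ^ (q1 * q2)\<close>,
    the size that the vertex monomial must have when \<open>\<rho> = T\<close>.\<close>
  define w :: complex where "w = of_real (T ^ q2)"
  have w0: "w \<noteq> 0" using T by (simp add: w_def)
  have nw: "norm w = T ^ q2" using T by (simp add: w_def norm_power)
  have Q: "?Q > 0" using q by simp
  have dist: "i1 \<noteq> i2" "i1 \<noteq> i3" "i2 \<noteq> i3" using ends q by auto
  have "\<not> ((\<Sum>i\<in>I. C i * z powi a i * w powi b i) = 0 \<and>
    (\<Sum>i\<in>I. of_int (a i) * (C i * z powi a i * w powi b i)) = 0)" if z: "z \<noteq> 0" for z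
  proof
    assume H: "(\<Sum>i\<in>I. C i * z powi a i * w powi b i) = 0 \<and>
      (\<Sum>i\<in>I. of_int (a i) * (C i * z powi a i * w powi b i)) = 0"
    \<comment> \<open>The smallest scale at least \<open>T\<close> for which both \<open>z\<close>
      and its inverse are bounded by \<open>\<rho> ^ q1\<close>.\<close>
    define \<rho> where "\<rho> = max T (max (root q1 (norm z)) (root q1 (1 / norm z)))"
    define P where "P = \<rho> ^ (?Q - 1)"
    have \<rho>: "1 \<le> \<rho>" "T \<le> \<rho>" using T by (auto simp: \<rho>_def)
    have P1: "1 \<le> P" unfolding P_def using \<rho> by simp
    have rootpow: "root q1 (norm z) ^ q1 = norm z" "root q1 (1 / norm z) ^ q1 = 1 / norm z"
      using q by (simp_all add: real_root_pow_pos2)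
    have zr: "norm z \<le> \<rho> ^ q1" "1 / norm z \<le> \<rho> ^ q1"
    proof -
      have le: "root q1 (norm z) \<le> \<rho>" "root q1 (1 / norm z) \<le> \<rho>" by (simp_all add: \<rho>_def)
      have "0 \<le> root q1 (norm z)" "0 \<le> root q1 (1 / norm z)" using q by simp_all
      from power_mono[OF le(1) this(1), of q1] power_mono[OF le(2) this(2), of q1]
      show "norm z \<le> \<rho> ^ q1" "1 / norm z \<le> \<rho> ^ q1" by (simp_all only: rootpow)
    qed
    have wr: "norm w \<le> \<rho> ^ q2" "1 / norm w \<le> \<rho> ^ q2"
    proof -
      show "norm w \<le> \<rho> ^ q2" unfolding nw using \<rho> T by (intro power_mono) auto
      have "1 / norm w \<le> 1" unfolding nw using T by simp
      also have "1 \<le> \<rho> ^ q2" using \<rho> by simp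
      finally show "1 / norm w \<le> \<rho> ^ q2" .
    qed
    have mon: "norm (z powi a i * w powi b i) \<le> P" if i: "i \<in> I - {i1, i2, i3}" "C i \<noteq> 0" for i
      using supp[OF i]
    proof
      assume "a i = 0 \<and> b i = - int q1"
      hence "norm (z powi a i * w powi b i) = inverse (norm w) ^ q1"
        by (simp add: norm_mult power_int_minus norm_inverse norm_power power_inverse)
      also have "\<dots> \<le> 1" unfolding nw using T by (intro power_le_one) (simp_all add: inverse_le_1_iff)
      finally show ?thesis using P1 by simp
    next
      assume lt: "\<bar>a i\<bar> * int q1 + \<bar>b i\<bar> * int q2 < int q1 * int q2"
      have "norm (z powi a i * w powi b i) \<le> (\<rho> ^ q1) ^ nat \<bar>a i\<bar> * (\<rho> ^ q2) ^ nat \<bar>b i\<bar>"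
        unfolding norm_mult
        by (intro mult_mono norm_power_int_le z zr w0 wr) (use \<rho> in auto)
      also have "\<dots> = \<rho> ^ (q1 * nat \<bar>a i\<bar> + q2 * nat \<bar>b i\<bar>)" by (simp add: power_add power_mult)
      also have "\<dots> \<le> P" unfolding P_def
      proof (rule power_increasing[OF _ \<rho>(1)])
        have "int (q1 * nat \<bar>a i\<bar> + q2 * nat \<bar>b i\<bar>) < int ?Q" using lt by (simp add: mult.commute)
        thus "q1 * nat \<bar>a i\<bar> + q2 * nat \<bar>b i\<bar> \<le> ?Q - 1" by linarith
      qed
      finally show ?thesis .
    qed
    let ?t = "\<lambda>i. C i * z powi a i * w powi b i"
    define E0 where "E0 = (\<Sum>i\<in>I - {i1, i2, i3}. ?t i)"
    define E1 where "E1 = (\<Sum>i\<in>I - {i1, i2, i3}. of_int (a i) * ?t i)"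
    have tb: "norm (?t i) \<le> norm (C i) * P" if "i \<in> I - {i1, i2, i3}" for i
      using mon[OF that] by (cases "C i = 0") (simp_all add: norm_mult mult.assoc mult_left_mono)
    have MP: "(\<Sum>i\<in>I - {i1, i2, i3}. norm (C i) * (1 + \<bar>of_int (a i)\<bar>) * P) \<le> M * P"
      unfolding M_def sum_distrib_right
      by (rule sum_mono2[OF fin]) (use P1 in auto)
    have "norm E0 \<le> (\<Sum>i\<in>I - {i1, i2, i3}. norm (C i) * (1 + \<bar>of_int (a i)\<bar>) * P)"
      unfolding E0_def
    proof (rule sum_norm_le)
      fix i assume i: "i \<in> I - {i1, i2, i3}"
      have "norm (C i) * P * 1 \<le> norm (C i) * P * (1 + \<bar>of_int (a i)\<bar>)"
        using P1 by (intro mult_left_mono) auto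
      thus "norm (?t i) \<le> norm (C i) * (1 + \<bar>of_int (a i)\<bar>) * P"
        using tb[OF i] by (simp add: mult_ac)
    qed
    with MP have E0: "norm E0 \<le> M * P" by linarith
    have "norm E1 \<le> (\<Sum>i\<in>I - {i1, i2, i3}. norm (C i) * (1 + \<bar>of_int (a i)\<bar>) * P)"
      unfolding E1_def
    proof (rule sum_norm_le)
      fix i assume i: "i \<in> I - {i1, i2, i3}"
      have "norm (of_int (a i) * ?t i) = \<bar>of_int (a i)\<bar> * norm (?t i)"
        by (simp only: norm_mult norm_of_int)
      also have "\<dots> \<le> (1 + \<bar>of_int (a i)\<bar>) * (norm (C i) * P)"
        using tb[OF i] by (intro mult_mono) auto
      finally show "norm (of_int (a i) * ?t i) \<le> norm (C i) * (1 + \<bar>of_int (a i)\<bar>) * P"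
        by (simp add: mult_ac)
    qed
    with MP have E1: "norm E1 \<le> M * P" by linarith
    have split: "sum g I = g i1 + g i2 + g i3 + sum g (I - {i1, i2, i3})" for g :: "'i \<Rightarrow> complex"
    proof -
      have "sum g I = sum g {i1, i2, i3} + sum g (I - {i1, i2, i3})"
        using ends by (subst add.commute, intro sum.subset_diff fin) auto
      thus ?thesis using dist by (simp add: add.assoc)
    qed
    let ?u = "z ^ q2" and ?x = "w ^ q1"
    have e0: "C i1 * ?u + C i2 * inverse ?u + C i3 * ?x + E0 = 0"
      using H split[of ?t] ends by (simp add: E0_def power_int_minus)
    have e1: "of_real (real q2) * (C i1 * ?u - C i2 * inverse ?u) + E1 = 0"
      using H split[of "\<lambda>i. of_int (a i) * ?t i"] ends
      by (simp add: E1_def power_int_minus algebra_simps)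
    have Ki: "norm u \<le> K * P" if "norm u \<le> k * P"
      "k \<in> {(norm (C i2) + M) / norm (C i1), (norm (C i1) + M) / norm (C i2),
        2 * (norm (C i2) + M) / norm (C i3), 2 * (norm (C i1) + M) / norm (C i3)}" for k u
    proof -
      have "k \<le> K" unfolding K_def using that(2) by (intro Max_ge) auto
      hence "k * P \<le> K * P" using P1 by (intro mult_right_mono) auto
      with that(1) show ?thesis by linarith
    qed
    have nu: "norm ?u = norm z ^ q2" by (simp add: norm_power)
    have xb: "norm ?x = T ^ ?Q" by (simp add: norm_power nw power_mult mult.commute[of q1])
    have c1: "1 \<le> real q2" "0 \<le> P" using q P1 by simp_all
    have "\<rho> ^ ?Q \<le> K * P"
    \<comment> \<open>If \<open>norm z\<close> is at least 1, the inverse power plays the small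
      monomial \<open>v\<close>; otherwise the two powers exchange roles and the sign of
      \<open>E1\<close> flips. In either case \<open>\<rho> ^ ?Q\<close> is the norm of
      \<open>?x\<close> or of the larger of the two powers.\<close>
    proof (cases "1 \<le> norm z")
      case True
      hence "1 / norm z \<le> norm z" by (simp add: divide_le_eq) (metis mult_mono norm_ge_zero mult_1 zero_le_one order_trans)
      hence "root q1 (1 / norm z) \<le> root q1 (norm z)" using q by simp
      hence \<rho>': "\<rho> = T \<or> \<rho> = root q1 (norm z)" unfolding \<rho>_def by linarith
      have "norm (inverse ?u) \<le> 1"
        using True by (simp add: norm_inverse nu inverse_le_1_iff)
      hence v: "norm (inverse ?u) \<le> P" using P1 by linarith
      note bd = extreme_monomials_bound[OF ends(4,6) c1 M0 e0 e1 v E0 E1]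
      have "norm ?u \<le> K * P" by (rule Ki[OF conjunct1[OF bd]]) blast
      moreover have "norm ?x \<le> K * P" by (rule Ki[OF conjunct2[OF bd]]) blast
      ultimately show ?thesis using \<rho>' xb rootpow nu by (auto simp: power_mult)
    next
      case False
      hence "norm z \<le> 1 / norm z" using z by (simp add: le_divide_eq mult_le_one)
      hence "root q1 (norm z) \<le> root q1 (1 / norm z)" using q by simp
      hence \<rho>': "\<rho> = T \<or> \<rho> = root q1 (1 / norm z)" unfolding \<rho>_def by linarith
      have "norm ?u \<le> 1" using False by (simp add: nu power_le_one)
      hence v: "norm ?u \<le> P" using P1 by linarith
      have e0': "C i2 * inverse ?u + C i1 * ?u + C i3 * ?x + E0 = 0" using e0 by (simp add: add_ac)
      have e1': "of_real (real q2) * (C i2 * inverse ?u - C i1 * ?u) + (- E1) = 0"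
        using e1 by (simp add: algebra_simps)
      have "norm (- E1) \<le> M * P" using E1 by simp
      note bd = extreme_monomials_bound[OF ends(5,6) c1 M0 e0' e1' v E0 this]
      have "norm (inverse ?u) \<le> K * P" by (rule Ki[OF conjunct1[OF bd]]) blast
      moreover have "norm ?x \<le> K * P" by (rule Ki[OF conjunct2[OF bd]]) blast
      moreover have "norm (inverse ?u) = (1 / norm z) ^ q2"
        by (simp only: norm_inverse nu power_one_over inverse_eq_divide norm_divide norm_one)
      ultimately show ?thesis using \<rho>' xb rootpow by (auto simp: power_mult)
    qed
    \<comment> \<open>The contradiction comes from \<open>K < T \<le> \<rho>\<close>: a vertex
      monomial would be smaller than its own size.\<close>
    also have "\<dots> < \<rho> * P" using T \<rho> P1 by (intro mult_strict_right_mono) auto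
    also have "\<rho> * P = \<rho> ^ ?Q" unfolding P_def using Q by (metis power_Suc Suc_diff_1)
    finally show False by simp
  qed
  with w0 show ?thesis by blast
qed

section \<open>The determinant as a Laurent polynomial\<close>

lemma power_int_sum_eq: "z \<noteq> 0 \<Longrightarrow> (\<Prod>i\<in>A. z powi f i) = z powi (\<Sum>i\<in>A. f i)"
  for z :: "'a::field"
  by (induction A rule: infinite_finite_induct) (auto simp: power_int_add)

text \<open>\<open>(0, 0)\<close> stands for the potential term of the operator.\<close>

definition steps :: "(int \<times> int) set" where
  "steps = {(0, 0), (1, 0), (-1, 0), (0, 1), (0, -1)}"

locale period_cell =
  fixes q1 q2 :: nat
  assumes q1_pos: "0 < q1" and q2_pos: "0 < q2" and coprime: "coprime q1 q2"
begin

definition move :: "nat \<Rightarrow> int \<times> int \<Rightarrow> int \<times> int" where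
  "move i d = (fst (fb_pt q1 i) + fst d, snd (fb_pt q1 i) + snd d)"

text \<open>The number of periods between a point and its representative in the fundamental cell,
  that is, the exponent of the Floquet phase. The shift by 1 reflects that cell coordinates start at
  1.\<close>

definition wind1 :: "int \<times> int \<Rightarrow> int" where "wind1 n = (fst n - 1) div int q1"
definition wind2 :: "int \<times> int \<Rightarrow> int" where "wind2 n = (snd n - 1) div int q2"

definition weight :: "(int \<times> int \<Rightarrow> real) \<Rightarrow> complex \<Rightarrow> nat \<Rightarrow> int \<times> int \<Rightarrow> complex" where
  "weight V l i d = (if d = (0, 0) then complex_of_real (V (fb_pt q1 i)) - l else 1)"

text \<open>This is the matrix of the operator minus \<open>l\<close>, with the two Floquet phases
  replaced by free variables \<open>z\<close> and \<open>w\<close>. Entries are sums over steps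
  because for small periods several steps can lead to the same index.\<close>

definition bloch_mat ::
  "(int \<times> int \<Rightarrow> real) \<Rightarrow> complex \<Rightarrow> complex \<Rightarrow> complex \<Rightarrow> complex mat" where
  "bloch_mat V l z w = mat (q1 * q2) (q1 * q2) (\<lambda>(i, j). \<Sum>d\<in>steps.
     if fb_idx q1 q2 (move i d) = j
     then weight V l i d * z powi wind1 (move i d) * w powi wind2 (move i d) else 0)"

lemma finite_steps [simp]: "finite steps" by (simp add: steps_def)

lemma bloch_mat_carrier [simp]: "bloch_mat V l z w \<in> carrier_mat (q1 * q2) (q1 * q2)"
  by (simp add: bloch_mat_def)

lemma fb_idx_less: "fb_idx q1 q2 n < q1 * q2"
proof -
  have "nat ((fst n - 1) mod int q1) < q1" "nat ((snd n - 1) mod int q2) < q2"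
    using q1_pos q2_pos by (simp_all add: nat_less_iff)
  hence "fb_idx q1 q2 n < q1 + q1 * nat ((snd n - 1) mod int q2)"
    "q1 * Suc (nat ((snd n - 1) mod int q2)) \<le> q1 * q2"
    unfolding fb_idx_def by (simp, intro mult_le_mono2, simp)
  thus ?thesis by simp
qed

lemma fb_idx_mod_div:
  "int (fb_idx q1 q2 n mod q1) = (fst n - 1) mod int q1"
  "int (fb_idx q1 q2 n div q1) = (snd n - 1) mod int q2"
  using q1_pos q2_pos by (simp_all add: fb_idx_def nat_less_iff)

lemma winding_decomp:
  "fst n = fst (fb_pt q1 (fb_idx q1 q2 n)) + int q1 * wind1 n"
  "snd n = snd (fb_pt q1 (fb_idx q1 q2 n)) + int q2 * wind2 n"
proof -
  have "fst n - 1 = int q1 * wind1 n + (fst n - 1) mod int q1"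
    "snd n - 1 = int q2 * wind2 n + (snd n - 1) mod int q2"
    by (simp_all add: wind1_def wind2_def)
  thus "fst n = fst (fb_pt q1 (fb_idx q1 q2 n)) + int q1 * wind1 n"
    "snd n = snd (fb_pt q1 (fb_idx q1 q2 n)) + int q2 * wind2 n"
    by (simp_all add: fb_pt_def fb_idx_mod_div)
qed

lemma fb_pt_mod_div:
  assumes "i < q1 * q2"
  shows "(fst (fb_pt q1 i) - 1) mod int q1 = int (i mod q1)"
    "(fst (fb_pt q1 i) - 1) div int q1 = 0"
    "(snd (fb_pt q1 i) - 1) mod int q2 = int (i div q1)"
    "(snd (fb_pt q1 i) - 1) div int q2 = 0"
proof -
  have "i div q1 < q2" using assms by (simp add: less_mult_imp_div_less mult.commute)
  thus "(fst (fb_pt q1 i) - 1) mod int q1 = int (i mod q1)"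
    "(fst (fb_pt q1 i) - 1) div int q1 = 0"
    "(snd (fb_pt q1 i) - 1) mod int q2 = int (i div q1)"
    "(snd (fb_pt q1 i) - 1) div int q2 = 0"
    using q1_pos by (simp_all add: fb_pt_def flip: zmod_int zdiv_int)
qed

lemma fb_idx_fb_pt:
  assumes "i < q1 * q2"
  shows "fb_idx q1 q2 (fb_pt q1 i) = i"
  unfolding fb_idx_def fb_pt_mod_div[OF assms] by simp

lemma fst_move: "fst (move i d) = fst (fb_pt q1 i) + fst d"
  and snd_move: "snd (move i d) = snd (fb_pt q1 i) + snd d"
  by (simp_all add: move_def)

lemma move_0 [simp]: "move i (0, 0) = fb_pt q1 i"
  by (simp add: move_def)

lemma bloch_mat_D_V:
  "bloch_mat V l (cis (2 * pi * fst k)) (cis (2 * pi * snd k)) = D_V q1 q2 V k - l \<cdot>\<^sub>m 1\<^sub>m (q1 * q2)"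
proof (rule eq_matI)
  fix i j
  assume "i < dim_row (D_V q1 q2 V k - l \<cdot>\<^sub>m 1\<^sub>m (q1 * q2))"
    "j < dim_col (D_V q1 q2 V k - l \<cdot>\<^sub>m 1\<^sub>m (q1 * q2))"
  hence ij: "i < q1 * q2" "j < q1 * q2" by (simp_all add: D_V_def)
  let ?T = "\<lambda>d. if fb_idx q1 q2 (move i d) = j then fb_phase q1 q2 k (move i d) else 0"
  define z w where "z = cis (2 * pi * fst k)" and "w = cis (2 * pi * snd k)"
  have ph: "z powi wind1 n * w powi wind2 n = fb_phase q1 q2 k n" for n
    by (simp add: z_def w_def cis_power_int cis_mult fb_phase_def wind1_def wind2_def algebra_simps)
  have "bloch_mat V l z w $$ (i, j) =
    (\<Sum>d\<in>steps. if fb_idx q1 q2 (move i d) = j then weight V l i d * fb_phase q1 q2 k (move i d) else 0)"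
    using ij by (simp add: bloch_mat_def mult.assoc ph cong: if_cong)
  also have "\<dots> = (if i = j then complex_of_real (V (fb_pt q1 i)) - l else 0) +
      (?T (1, 0) + (?T (-1, 0) + (?T (0, 1) + ?T (0, -1))))"
  proof -
    have "fb_phase q1 q2 k (fb_pt q1 i) = 1"
      by (simp add: fb_phase_def fb_pt_mod_div[OF ij(1)])
    thus ?thesis
      using fb_idx_fb_pt[OF ij(1)] by (cases "i = j") (auto simp: steps_def weight_def)
  qed
  also have "\<dots> = (D_V q1 q2 V k - l \<cdot>\<^sub>m 1\<^sub>m (q1 * q2)) $$ (i, j)"
  proof -
    have "D_V q1 q2 V k $$ (i, j) = (if i = j then complex_of_real (V (fb_pt q1 i)) else 0) +
        (?T (1, 0) + (?T (-1, 0) + (?T (0, 1) + ?T (0, -1))))"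
      using ij by (simp only: D_V_def index_mat prod.case list.map sum_list.Cons sum_list.Nil move_def
          fst_conv snd_conv add_0_right diff_conv_add_uminus)
    thus ?thesis using ij by (simp add: D_V_def)
  qed
  finally show "bloch_mat V l (cis (2 * pi * fst k)) (cis (2 * pi * snd k)) $$ (i, j) =
    (D_V q1 q2 V k - l \<cdot>\<^sub>m 1\<^sub>m (q1 * q2)) $$ (i, j)"
    by (simp only: z_def w_def)
qed (simp_all add: bloch_mat_def D_V_def)

type_synonym walk = "(nat \<Rightarrow> nat) \<times> (nat \<Rightarrow> int \<times> int)"

text \<open>The choice of steps is extensional, so that it is determined by its values on the
  indices and no Leibniz term is listed twice.\<close>

definition walks :: "walk set" where
  "walks = {p. p permutes {0..<q1 * q2}} \<times> ({0..<q1 * q2} \<rightarrow>\<^sub>E steps)"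

definition wcoeff :: "(int \<times> int \<Rightarrow> real) \<Rightarrow> complex \<Rightarrow> walk \<Rightarrow> complex" where
  "wcoeff V l x = signof (fst x) * (\<Prod>i=0..<q1 * q2.
     if fb_idx q1 q2 (move i (snd x i)) = fst x i then weight V l i (snd x i) else 0)"

definition wexp1 :: "walk \<Rightarrow> int" where "wexp1 x = (\<Sum>i=0..<q1 * q2. wind1 (move i (snd x i)))"
definition wexp2 :: "walk \<Rightarrow> int" where "wexp2 x = (\<Sum>i=0..<q1 * q2. wind2 (move i (snd x i)))"

lemma finite_walks [simp]: "finite walks"
  unfolding walks_def by (intro finite_cartesian_product finite_permutations finite_PiE) auto

text \<open>In the Leibniz expansion every factor picks one step, so a term is indexed by a permutation
  together with a choice of steps; its exponents are the total winding numbers.\<close>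

lemma det_bloch_mat:
  assumes z: "z \<noteq> 0" and w: "w \<noteq> 0"
  shows "det (bloch_mat V l z w) = (\<Sum>x\<in>walks. wcoeff V l x * z powi wexp1 x * w powi wexp2 x)"
proof -
  let ?S = "{0..<q1 * q2}"
  let ?E = "\<lambda>i j d. if fb_idx q1 q2 (move i d) = j
     then weight V l i d * z powi wind1 (move i d) * w powi wind2 (move i d) else 0"
  have "det (bloch_mat V l z w) = (\<Sum>p | p permutes ?S. signof p * (\<Prod>i\<in>?S. \<Sum>d\<in>steps. ?E i (p i) d))"
    unfolding det_def'[OF bloch_mat_carrier]
    by (intro sum.cong refl arg_cong2[where f = "(*)"] prod.cong)
      (auto simp: bloch_mat_def dest: permutes_in_image)
  also have "\<dots> = (\<Sum>p | p permutes ?S. \<Sum>\<delta>\<in>?S \<rightarrow>\<^sub>E steps. signof p * (\<Prod>i\<in>?S. ?E i (p i) (\<delta> i)))"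
    by (simp add: prod_sum_PiE sum_distrib_left)
  also have "\<dots> = (\<Sum>x\<in>walks. signof (fst x) * (\<Prod>i\<in>?S. ?E i (fst x i) (snd x i)))"
    unfolding walks_def by (subst sum.cartesian_product) (simp add: case_prod_unfold)
  also have "\<dots> = (\<Sum>x\<in>walks. wcoeff V l x * z powi wexp1 x * w powi wexp2 x)"
  proof (intro sum.cong refl)
    fix x
    have "(\<Prod>i\<in>?S. ?E i (fst x i) (snd x i)) =
      (\<Prod>i\<in>?S. (if fb_idx q1 q2 (move i (snd x i)) = fst x i then weight V l i (snd x i) else 0) *
        (z powi wind1 (move i (snd x i)) * w powi wind2 (move i (snd x i))))"
      by (intro prod.cong) auto
    thus "signof (fst x) * (\<Prod>i\<in>?S. ?E i (fst x i) (snd x i)) =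
      wcoeff V l x * z powi wexp1 x * w powi wexp2 x"
      by (simp only: prod.distrib power_int_sum_eq[OF z] power_int_sum_eq[OF w]
          wcoeff_def wexp1_def wexp2_def mult.assoc)
  qed
  finally show ?thesis .
qed

text \<open>A nonzero coefficient means that each step leads from its site to a translate of the
  image site under the permutation. Summed over all sites, the base points cancel, and only periods
  times winding numbers remain.\<close>

lemma wcoeff_nonzero_displacement:
  assumes x: "x \<in> walks" and c: "wcoeff V l x \<noteq> 0"
  shows "int q1 * wexp1 x = (\<Sum>i=0..<q1 * q2. fst (snd x i))"
    "int q2 * wexp2 x = (\<Sum>i=0..<q1 * q2. snd (snd x i))"
proof -
  let ?S = "{0..<q1 * q2}"
  have p: "fst x permutes ?S" using x by (auto simp: walks_def)
  have idx: "fb_idx q1 q2 (move i (snd x i)) = fst x i" if "i \<in> ?S" for i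
    using c that by (auto simp: wcoeff_def split: if_splits)
  have perm: "(\<Sum>i\<in>?S. g (fst x i)) = sum g ?S" for g :: "nat \<Rightarrow> int"
    using sum.permute[OF p, of g] by (simp add: o_def)
  have "(\<Sum>i\<in>?S. fst (fb_pt q1 i) + fst (snd x i)) =
      (\<Sum>i\<in>?S. fst (fb_pt q1 (fst x i)) + int q1 * wind1 (move i (snd x i)))"
    using winding_decomp(1) idx by (intro sum.cong refl) (metis fst_move)
  thus "int q1 * wexp1 x = (\<Sum>i=0..<q1 * q2. fst (snd x i))"
    using perm[of "\<lambda>i. fst (fb_pt q1 i)"] by (simp add: sum.distrib wexp1_def sum_distrib_left)
  have "(\<Sum>i\<in>?S. snd (fb_pt q1 i) + snd (snd x i)) =
      (\<Sum>i\<in>?S. snd (fb_pt q1 (fst x i)) + int q2 * wind2 (move i (snd x i)))"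
    using winding_decomp(2) idx by (intro sum.cong refl) (metis snd_move)
  thus "int q2 * wexp2 x = (\<Sum>i=0..<q1 * q2. snd (snd x i))"
    using perm[of "\<lambda>i. snd (fb_pt q1 i)"] by (simp add: sum.distrib wexp2_def sum_distrib_left)
qed

text \<open>There is one step per site and each has l1-length at most 1, so the total displacement
  has l1-length at most \<open>q1 * q2\<close>.\<close>

lemma wcoeff_nonzero_bound:
  assumes x: "x \<in> walks" and c: "wcoeff V l x \<noteq> 0"
  shows "\<bar>wexp1 x\<bar> * int q1 + \<bar>wexp2 x\<bar> * int q2 \<le> int q1 * int q2"
proof -
  let ?S = "{0..<q1 * q2}"
  have st: "snd x i \<in> steps" if "i \<in> ?S" for i using x that by (auto simp: walks_def)
  have "\<bar>wexp1 x\<bar> * int q1 + \<bar>wexp2 x\<bar> * int q2 = \<bar>int q1 * wexp1 x\<bar> + \<bar>int q2 * wexp2 x\<bar>"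
    by (simp add: abs_mult mult.commute)
  also have "\<dots> \<le> (\<Sum>i\<in>?S. \<bar>fst (snd x i)\<bar>) + (\<Sum>i\<in>?S. \<bar>snd (snd x i)\<bar>)"
    unfolding wcoeff_nonzero_displacement[OF x c] by (intro add_mono sum_abs)
  also have "\<dots> = (\<Sum>i\<in>?S. \<bar>fst (snd x i)\<bar> + \<bar>snd (snd x i)\<bar>)" by (simp add: sum.distrib)
  also have "\<dots> \<le> (\<Sum>i\<in>?S. 1)"
    by (intro sum_mono) (use st in \<open>force simp: steps_def\<close>)
  finally show ?thesis by simp
qed

section \<open>Vertices of the Newton polygon\<close>

text \<open>All sites take the same step, so the permutation is a translation of the torus. For the
  four nonzero steps these walks are the vertices of the Newton polygon.\<close>

definition uniform_walk :: "int \<times> int \<Rightarrow> walk" where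
  "uniform_walk d = (\<lambda>i. if i < q1 * q2 then fb_idx q1 q2 (move i d) else i,
     restrict (\<lambda>_. d) {0..<q1 * q2})"

lemma uniform_walk_in_walks:
  assumes "d \<in> steps"
  shows "uniform_walk d \<in> walks"
proof -
  let ?S = "{0..<q1 * q2}" and ?h = "\<lambda>i. fb_idx q1 q2 (move i d)"
  have "inj_on ?h ?S"
  proof (rule inj_onI)
    fix i j assume ij: "i \<in> ?S" "j \<in> ?S" and e: "?h i = ?h j"
    have "(fst (move i d) - 1) mod int q1 = (fst (move j d) - 1) mod int q1"
      "(snd (move i d) - 1) mod int q2 = (snd (move j d) - 1) mod int q2"
      using fb_idx_mod_div[of "move i d"] fb_idx_mod_div[of "move j d"] e by simp_all
    hence "(fst (fb_pt q1 i) - 1) mod int q1 = (fst (fb_pt q1 j) - 1) mod int q1"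
      "(snd (fb_pt q1 i) - 1) mod int q2 = (snd (fb_pt q1 j) - 1) mod int q2"
      by (simp_all add: move_def mod_eq_dvd_iff algebra_simps)
    hence "i mod q1 = j mod q1" "i div q1 = j div q1"
      using ij by (simp_all add: fb_pt_mod_div)
    thus "i = j" by (metis div_mult_mod_eq)
  qed
  moreover have "?h ` ?S \<subseteq> ?S" by (intro image_subsetI) (simp add: fb_idx_less)
  ultimately have "bij_betw ?h ?S ?S"
    by (simp add: bij_betw_def endo_inj_surj)
  hence "bij_betw (\<lambda>i. if i < q1 * q2 then ?h i else i) ?S ?S"
    by (rule iffD1[OF bij_betw_cong, rotated]) simp
  hence "(\<lambda>i. if i < q1 * q2 then ?h i else i) permutes ?S"
    by (rule bij_imp_permutes) simp
  thus ?thesis using assms by (auto simp: walks_def uniform_walk_def)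
qed

text \<open>Every weight is 1, so the coefficient is the sign of the translation; the exponents
  follow from the total displacement.\<close>

lemma wcoeff_uniform_walk:
  assumes "d \<in> steps - {(0, 0)}"
  shows "wcoeff V l (uniform_walk d) \<noteq> 0"
    "wexp1 (uniform_walk d) = int q2 * fst d" "wexp2 (uniform_walk d) = int q1 * snd d"
proof -
  have "d \<in> steps" using assms by simp
  note w = uniform_walk_in_walks[OF this]
  show nz: "wcoeff V l (uniform_walk d) \<noteq> 0" for V l
    using assms by (auto simp: wcoeff_def uniform_walk_def weight_def sign_def)
  have "int q1 * wexp1 (uniform_walk d) = int q1 * (int q2 * fst d)"
    "int q2 * wexp2 (uniform_walk d) = int q2 * (int q1 * snd d)"
    using wcoeff_nonzero_displacement[OF w nz] by (simp_all add: uniform_walk_def mult_ac)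
  thus "wexp1 (uniform_walk d) = int q2 * fst d" "wexp2 (uniform_walk d) = int q1 * snd d"
    using q1_pos q2_pos by simp_all
qed

lemma walk_eq_uniform:
  assumes x: "x \<in> walks" and c: "wcoeff V l x \<noteq> 0" and d: "\<And>i. i < q1 * q2 \<Longrightarrow> snd x i = d"
  shows "x = uniform_walk d"
proof (rule prod_eqI)
  have p: "fst x permutes {0..<q1 * q2}" and e: "snd x \<in> {0..<q1 * q2} \<rightarrow>\<^sub>E steps"
    using x by (auto simp: walks_def)
  show "snd x = snd (uniform_walk d)"
    using d PiE_arb[OF e] by (auto simp: uniform_walk_def restrict_def)
  show "fst x = fst (uniform_walk d)"
  proof
    fix i show "fst x i = fst (uniform_walk d) i"
    proof (cases "i < q1 * q2")
      case True
      hence "fb_idx q1 q2 (move i (snd x i)) = fst x i"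
        using c by (auto simp: wcoeff_def split: if_splits)
      thus ?thesis using True d by (simp add: uniform_walk_def)
    next
      case False
      thus ?thesis using permutes_not_in[OF p, of i] by (simp add: uniform_walk_def)
    qed
  qed
qed

lemma sum_int_eq_card_imp_all_one:
  fixes g :: "nat \<Rightarrow> int"
  assumes "(\<Sum>i=0..<N. g i) = int N" "\<And>i. i < N \<Longrightarrow> g i \<le> 1" "i < N"
  shows "g i = 1"
proof -
  have "(\<Sum>i=0..<N. 1 - g i) = 0" using assms(1) by (simp add: sum_subtractf)
  hence "\<forall>i\<in>{0..<N}. 1 - g i = 0" using assms(2) by (subst (asm) sum_nonneg_eq_0_iff) auto
  thus ?thesis using assms(3) by simp
qed

text \<open>A vertex exponent requires the maximal displacement in direction \<open>d\<close>, which
  leaves no freedom in any step. Hence no other term can cancel the vertex monomials.\<close>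

lemma extreme_walk:
  assumes x: "x \<in> walks" and c: "wcoeff V l x \<noteq> 0" and d: "d \<in> steps - {(0, 0)}"
    and e: "wexp1 x = int q2 * fst d" "wexp2 x = int q1 * snd d"
  shows "x = uniform_walk d"
proof (rule walk_eq_uniform[OF x c])
  fix i assume i: "i < q1 * q2"
  have st: "snd x i \<in> steps" if "i < q1 * q2" for i using x that by (auto simp: walks_def)
  have dd: "fst d * fst d + snd d * snd d = 1" using d by (auto simp: steps_def)
  have s: "(\<Sum>i=0..<q1 * q2. fst (snd x i)) = int (q1 * q2) * fst d"
    "(\<Sum>i=0..<q1 * q2. snd (snd x i)) = int (q1 * q2) * snd d"
    using wcoeff_nonzero_displacement[OF x c] e by (simp_all add: mult_ac)
  \<comment> \<open>The inner product of a step with \<open>d\<close> is at most 1, so a sum equal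
    to the number of sites makes each of them equal to 1.\<close>
  have "(\<Sum>i=0..<q1 * q2. fst d * fst (snd x i) + snd d * snd (snd x i)) =
      int (q1 * q2) * (fst d * fst d + snd d * snd d)"
    by (simp add: sum.distrib s algebra_simps flip: sum_distrib_left)
  hence "fst d * fst (snd x i) + snd d * snd (snd x i) = 1"
    by (intro sum_int_eq_card_imp_all_one[OF _ _ i])
      (use d st in \<open>force simp: dd steps_def\<close>)+
  thus "snd x i = d" using st[OF i] d by (auto simp: steps_def)
qed

text \<open>This is where coprimality enters: the edges of the Newton polygon carry no lattice points
  except the vertices.\<close>

lemma boundary_exponents:
  fixes a b :: int
  assumes e: "\<bar>a\<bar> * int q1 + \<bar>b\<bar> * int q2 = int q1 * int q2"
  shows "(\<bar>a\<bar> = int q2 \<and> b = 0) \<or> (a = 0 \<and> \<bar>b\<bar> = int q1)"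
proof -
  have "int q2 dvd \<bar>a\<bar> * int q1"
    using e by (metis dvd_add_left_iff dvd_triv_right)
  hence dv: "int q2 dvd \<bar>a\<bar>"
    using coprime by (simp add: coprime_dvd_mult_left_iff coprime_commute)
  have "\<bar>a\<bar> * int q1 \<le> int q2 * int q1" using e by (simp add: mult.commute) (metis abs_ge_zero le_add_same_cancel1 mult_nonneg_nonneg of_nat_0_le_iff mult.commute)
  hence "\<bar>a\<bar> \<le> int q2" using q1_pos by simp
  hence "\<bar>a\<bar> = 0 \<or> \<bar>a\<bar> = int q2" using dv zdvd_imp_le[of "int q2" "\<bar>a\<bar>"] by linarith
  thus ?thesis using e q1_pos q2_pos by (auto simp: mult.commute)
qed

section \<open>The determinant as a bivariate polynomial\<close>

text \<open>This is the Laurent polynomial times \<open>z ^ q2 * w ^ q1\<close>. The truncation by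
  \<open>nat\<close> can only act on terms whose coefficient is zero, by
  \<open>wexp_bounds\<close>.\<close>

definition bloch_poly :: "(int \<times> int \<Rightarrow> real) \<Rightarrow> complex \<Rightarrow> complex poly poly" where
  "bloch_poly V l = (\<Sum>x\<in>walks.
     monom (monom (wcoeff V l x) (nat (wexp2 x + int q1))) (nat (wexp1 x + int q2)))"

lemma wexp_bounds:
  assumes "x \<in> walks" "wcoeff V l x \<noteq> 0"
  shows "\<bar>wexp1 x\<bar> \<le> int q2" "\<bar>wexp2 x\<bar> \<le> int q1"
proof -
  note le = wcoeff_nonzero_bound[OF assms]
  have "0 \<le> \<bar>wexp1 x\<bar> * int q1" "0 \<le> \<bar>wexp2 x\<bar> * int q2" by simp_all
  with le have "\<bar>wexp1 x\<bar> * int q1 \<le> int q2 * int q1" "\<bar>wexp2 x\<bar> * int q2 \<le> int q1 * int q2"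
    by (simp_all only: mult.commute[of "int q2" "int q1"])
  thus "\<bar>wexp1 x\<bar> \<le> int q2" "\<bar>wexp2 x\<bar> \<le> int q1" using q1_pos q2_pos by simp_all
qed

lemma eval_coeffs_bloch_poly:
  "eval_coeffs w (bloch_poly V l) = (\<Sum>x\<in>walks.
     monom (wcoeff V l x * w ^ nat (wexp2 x + int q1)) (nat (wexp1 x + int q2)))"
proof (intro poly_eqI)
  fix k
  show "coeff (eval_coeffs w (bloch_poly V l)) k = coeff (\<Sum>x\<in>walks.
     monom (wcoeff V l x * w ^ nat (wexp2 x + int q1)) (nat (wexp1 x + int q2))) k"
    by (simp add: coeff_map_poly bloch_poly_def coeff_sum poly_sum)
      (intro sum.cong refl, simp add: poly_monom)
qed

lemma wcoeff_shift:
  assumes "x \<in> walks" "z \<noteq> 0" "w \<noteq> 0"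
  shows "wcoeff V l x * w ^ nat (wexp2 x + int q1) * z ^ nat (wexp1 x + int q2) =
    z ^ q2 * w ^ q1 * (wcoeff V l x * z powi wexp1 x * w powi wexp2 x)"
proof (cases "wcoeff V l x = 0")
  case False
  note b = wexp_bounds[OF assms(1) False]
  have "z ^ nat (wexp1 x + int q2) = z powi (wexp1 x + int q2)"
    "w ^ nat (wexp2 x + int q1) = w powi (wexp2 x + int q1)"
    using b by (simp_all add: power_int_def)
  thus ?thesis using assms by (simp add: power_int_add)
qed simp

lemma poly_bloch_poly:
  assumes "z \<noteq> 0" "w \<noteq> 0"
  shows "poly (eval_coeffs w (bloch_poly V l)) z = z ^ q2 * w ^ q1 * det (bloch_mat V l z w)"
  by (simp only: eval_coeffs_bloch_poly poly_sum poly_monom det_bloch_mat[OF assms] sum_distrib_left)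
    (intro sum.cong refl wcoeff_shift assms)

text \<open>The logarithmic derivative multiplies each monomial by its exponent and keeps the
  monomials themselves, which is the form needed for the Newton polygon estimate.\<close>

lemma poly_pderiv_bloch_poly:
  assumes z: "z \<noteq> 0" and w: "w \<noteq> 0"
  shows "z * poly (pderiv (eval_coeffs w (bloch_poly V l))) z = z ^ q2 * w ^ q1 *
    (\<Sum>x\<in>walks. (of_int (wexp1 x) + of_nat q2) * (wcoeff V l x * z powi wexp1 x * w powi wexp2 x))"
proof -
  have "z * poly (pderiv (eval_coeffs w (bloch_poly V l))) z = (\<Sum>x\<in>walks.
      z * poly (monom (of_nat (nat (wexp1 x + int q2)) * (wcoeff V l x * w ^ nat (wexp2 x + int q1)))
        (nat (wexp1 x + int q2) - 1)) z)"
    by (simp add: eval_coeffs_bloch_poly pderiv_sum pderiv_monom poly_sum sum_distrib_left)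
  also have "\<dots> = (\<Sum>x\<in>walks. (of_int (wexp1 x) + of_nat q2) *
      (wcoeff V l x * w ^ nat (wexp2 x + int q1) * z ^ nat (wexp1 x + int q2)))"
  proof (intro sum.cong refl)
    fix x assume x: "x \<in> walks"
    show "z * poly (monom (of_nat (nat (wexp1 x + int q2)) * (wcoeff V l x * w ^ nat (wexp2 x + int q1)))
        (nat (wexp1 x + int q2) - 1)) z = (of_int (wexp1 x) + of_nat q2) *
      (wcoeff V l x * w ^ nat (wexp2 x + int q1) * z ^ nat (wexp1 x + int q2))"
    proof (cases "wcoeff V l x = 0")
      case False
      define n where "n = nat (wexp1 x + int q2)"
      have "int n = wexp1 x + int q2" using wexp_bounds[OF x False] by (simp add: n_def)
      hence "(of_int (wexp1 x) + of_nat q2 :: complex) = of_nat n"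
        by (metis of_int_add of_int_of_nat_eq)
      thus ?thesis unfolding n_def[symmetric] by (cases n) (simp_all add: poly_monom)
    qed simp
  qed
  also have "\<dots> = z ^ q2 * w ^ q1 *
    (\<Sum>x\<in>walks. (of_int (wexp1 x) + of_nat q2) * (wcoeff V l x * z powi wexp1 x * w powi wexp2 x))"
    unfolding sum_distrib_left
    by (intro sum.cong refl, subst wcoeff_shift[OF _ z w]) (simp_all add: mult_ac)
  finally show ?thesis .
qed

text \<open>An extreme power of \<open>z\<close> uses up the whole step budget, so
  \<open>wexp2\<close> vanishes and only one walk contributes. The case \<open>(1, 0)\<close> is the
  leading coefficient, the case \<open>(-1, 0)\<close> the constant one; both are nonzero multiples
  of \<open>w ^ q1\<close>.\<close>

lemma coeff_bloch_poly_extreme: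
  assumes d: "d = (1, 0) \<or> d = (-1, 0)" and k: "int k = int q2 + int q2 * fst d"
  shows "coeff (bloch_poly V l) k = monom (wcoeff V l (uniform_walk d)) q1"
proof -
  have dst: "d \<in> steps - {(0, 0)}" using d by (auto simp: steps_def)
  note u = wcoeff_uniform_walk[OF dst]
  have k': "nat (wexp1 (uniform_walk d) + int q2) = k" "nat (wexp2 (uniform_walk d) + int q1) = q1"
    using k d by (auto simp: u)
  have ex: "x = uniform_walk d"
    if x: "x \<in> walks" "wcoeff V l x \<noteq> 0" "nat (wexp1 x + int q2) = k" for x
  proof (rule extreme_walk[OF x(1,2) dst])
    note b = wexp_bounds[OF x(1,2)]
    show a: "wexp1 x = int q2 * fst d" using x(3) k b by linarith
    hence "\<bar>wexp1 x\<bar> = int q2" using d by auto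
    hence "\<bar>wexp2 x\<bar> * int q2 \<le> 0"
      using wcoeff_nonzero_bound[OF x(1,2)] by (simp add: mult.commute)
    thus "wexp2 x = int q1 * snd d" using d q2_pos by (auto simp: mult_le_0_iff)
  qed
  have "coeff (bloch_poly V l) k = (\<Sum>x\<in>walks. if x = uniform_walk d
      then monom (wcoeff V l (uniform_walk d)) q1 else 0)"
    unfolding bloch_poly_def coeff_sum
  proof (intro sum.cong refl)
    fix x assume x: "x \<in> walks"
    show "coeff (monom (monom (wcoeff V l x) (nat (wexp2 x + int q1))) (nat (wexp1 x + int q2))) k =
        (if x = uniform_walk d then monom (wcoeff V l (uniform_walk d)) q1 else 0)"
    proof (cases "wcoeff V l x \<noteq> 0 \<and> nat (wexp1 x + int q2) = k")
      case True
      hence "x = uniform_walk d" using ex[OF x] by blast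
      thus ?thesis using k' by simp
    next
      case False
      moreover have "x \<noteq> uniform_walk d" using False u(1)[of V l] k'(1) by blast
      ultimately show ?thesis by auto
    qed
  qed
  also have "\<dots> = monom (wcoeff V l (uniform_walk d)) q1"
    using uniform_walk_in_walks[of d] dst by (subst sum.delta) auto
  finally show ?thesis .
qed

lemma degree_bloch_poly: "degree (bloch_poly V l) = 2 * q2"
proof (rule antisym)
  have "(1, 0) \<in> steps - {(0, 0)}" by (simp add: steps_def)
  from wcoeff_uniform_walk(1)[OF this] have "coeff (bloch_poly V l) (2 * q2) \<noteq> 0"
    by (subst coeff_bloch_poly_extreme[of "(1, 0)"]) auto
  thus "2 * q2 \<le> degree (bloch_poly V l)" by (rule le_degree)
  show "degree (bloch_poly V l) \<le> 2 * q2"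
    unfolding bloch_poly_def
  proof (rule degree_sum_le)
    fix x assume x: "x \<in> walks"
    show "degree (monom (monom (wcoeff V l x) (nat (wexp2 x + int q1))) (nat (wexp1 x + int q2))) \<le> 2 * q2"
      using wexp_bounds[OF x, of V l] by (cases "wcoeff V l x = 0") (auto simp: degree_monom_eq nat_le_iff)
  qed simp
qed

lemma degree_coeff_bloch_poly: "degree (coeff (bloch_poly V l) j) \<le> 2 * q1"
  unfolding bloch_poly_def coeff_sum
proof (rule degree_sum_le)
  fix x assume x: "x \<in> walks"
  show "degree (coeff (monom (monom (wcoeff V l x) (nat (wexp2 x + int q1))) (nat (wexp1 x + int q2))) j) \<le> 2 * q1"
    using wexp_bounds[OF x, of V l] by (cases "wcoeff V l x = 0") (auto simp: degree_monom_eq nat_le_iff)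
qed simp

lemma bloch_poly_squarefree_fibre:
  "\<exists>w. w \<noteq> 0 \<and> (\<forall>z. \<not> (poly (eval_coeffs w (bloch_poly V l)) z = 0 \<and>
     poly (pderiv (eval_coeffs w (bloch_poly V l))) z = 0))"
proof -
  have st: "(1, 0) \<in> steps - {(0, 0)}" "(-1, 0) \<in> steps - {(0, 0)}" "(0, 1) \<in> steps - {(0, 0)}"
    "(0, -1) \<in> steps - {(0, 0)}" by (auto simp: steps_def)
  note u = wcoeff_uniform_walk[OF st(1)] wcoeff_uniform_walk[OF st(2)] wcoeff_uniform_walk[OF st(3)]
  let ?U = "{uniform_walk (1, 0), uniform_walk (-1, 0), uniform_walk (0, 1)}"
  have "\<exists>w. w \<noteq> 0 \<and> (\<forall>z. z \<noteq> 0 \<longrightarrow>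
      \<not> ((\<Sum>x\<in>walks. wcoeff V l x * z powi wexp1 x * w powi wexp2 x) = 0 \<and>
      (\<Sum>x\<in>walks. of_int (wexp1 x) * (wcoeff V l x * z powi wexp1 x * w powi wexp2 x)) = 0))"
  proof (rule no_double_root_for_large_w[OF finite_walks q1_pos q2_pos])
    show "uniform_walk (1, 0) \<in> walks" "uniform_walk (-1, 0) \<in> walks" "uniform_walk (0, 1) \<in> walks"
      using st by (auto intro: uniform_walk_in_walks)
    fix x assume x: "x \<in> walks - ?U" and c: "wcoeff V l x \<noteq> 0"
    have xw: "x \<in> walks" using x by simp
    show "\<bar>wexp1 x\<bar> * int q1 + \<bar>wexp2 x\<bar> * int q2 < int q1 * int q2 \<or>
      wexp1 x = 0 \<and> wexp2 x = - int q1"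
    \<comment> \<open>A walk on the boundary sits at a vertex, and three of the vertices are taken
      by the uniform walks already singled out.\<close>
    proof (cases "\<bar>wexp1 x\<bar> * int q1 + \<bar>wexp2 x\<bar> * int q2 < int q1 * int q2")
      case False
      hence "\<bar>wexp1 x\<bar> * int q1 + \<bar>wexp2 x\<bar> * int q2 = int q1 * int q2"
        using wcoeff_nonzero_bound[OF xw c] by linarith
      note be = boundary_exponents[OF this]
      have "\<not> (wexp1 x = int q2 \<and> wexp2 x = 0)" "\<not> (wexp1 x = - int q2 \<and> wexp2 x = 0)"
        "\<not> (wexp1 x = 0 \<and> wexp2 x = int q1)"
        using extreme_walk[OF xw c st(1)] extreme_walk[OF xw c st(2)] extreme_walk[OF xw c st(3)] x
        by auto
      with be have "wexp1 x = 0 \<and> wexp2 x = - int q1" by linarith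
      thus ?thesis ..
    qed blast
  qed (simp_all add: u)
  then obtain w where w: "w \<noteq> 0" and nd: "\<And>z. z \<noteq> 0 \<Longrightarrow>
      \<not> ((\<Sum>x\<in>walks. wcoeff V l x * z powi wexp1 x * w powi wexp2 x) = 0 \<and>
      (\<Sum>x\<in>walks. of_int (wexp1 x) * (wcoeff V l x * z powi wexp1 x * w powi wexp2 x)) = 0)"
    by blast
  have "\<not> (poly (eval_coeffs w (bloch_poly V l)) z = 0 \<and>
     poly (pderiv (eval_coeffs w (bloch_poly V l))) z = 0)" for z
  proof (cases "z = 0")
    case True
    \<comment> \<open>The Laurent estimate covers only \<open>z \<noteq> 0\<close>; at 0 the
      constant coefficient rules out a root.\<close>
    have "coeff (bloch_poly V l) 0 = monom (wcoeff V l (uniform_walk (-1, 0))) q1"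
      by (rule coeff_bloch_poly_extreme) auto
    hence "poly (eval_coeffs w (bloch_poly V l)) 0 = wcoeff V l (uniform_walk (-1, 0)) * w ^ q1"
      by (simp add: poly_0_coeff_0 coeff_map_poly poly_monom)
    thus ?thesis using True u(4) w by simp
  next
    case False
    show ?thesis
    proof
      assume H: "poly (eval_coeffs w (bloch_poly V l)) z = 0 \<and>
        poly (pderiv (eval_coeffs w (bloch_poly V l))) z = 0"
      let ?t = "\<lambda>x. wcoeff V l x * z powi wexp1 x * w powi wexp2 x"
      have 1: "(\<Sum>x\<in>walks. ?t x) = 0"
        using H False w poly_bloch_poly[OF False w, of V l] by (simp add: det_bloch_mat)
      have "(\<Sum>x\<in>walks. (of_int (wexp1 x) + of_nat q2) * ?t x) = 0"
        using H False w poly_pderiv_bloch_poly[OF False w, of V l] by simp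
      \<comment> \<open>Clearing denominators shifts the logarithmic derivative by \<open>q2\<close>
        times the polynomial, which vanishes at a root.\<close>
      moreover have "(\<Sum>x\<in>walks. (of_int (wexp1 x) + of_nat q2) * ?t x) =
          (\<Sum>x\<in>walks. of_int (wexp1 x) * ?t x) + of_nat q2 * (\<Sum>x\<in>walks. ?t x)"
        by (simp add: distrib_right sum.distrib sum_distrib_left)
      ultimately have "(\<Sum>x\<in>walks. of_int (wexp1 x) * ?t x) = 0" using 1 by simp
      with 1 nd[OF False] show False by blast
    qed
  qed
  with w show ?thesis by blast
qed

text \<open>The leading coefficient in \<open>z\<close> is a nonzero multiple of
  \<open>w ^ q1\<close>, so its nonvanishing means \<open>w \<noteq> 0\<close>. The bound combines
  degree \<open>2 * q2\<close> in \<open>z\<close> with degree at most \<open>2 * q1\<close> in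
  \<open>w\<close>.\<close>

theorem card_double_roots_bloch_poly:
  "finite {(z, w). w \<noteq> 0 \<and> poly (eval_coeffs w (bloch_poly V l)) z = 0 \<and>
     poly (pderiv (eval_coeffs w (bloch_poly V l))) z = 0} \<and>
   card {(z, w). w \<noteq> 0 \<and> poly (eval_coeffs w (bloch_poly V l)) z = 0 \<and>
     poly (pderiv (eval_coeffs w (bloch_poly V l))) z = 0} \<le> 2 * q1 * (2 * (2 * q2) - 1)"
proof -
  have "(1, 0) \<in> steps - {(0, 0)}" by (simp add: steps_def)
  note c = wcoeff_uniform_walk(1)[OF this]
  have lead: "coeff (bloch_poly V l) (2 * q2) = monom (wcoeff V l (uniform_walk (1, 0))) q1"
    by (rule coeff_bloch_poly_extreme) auto
  have lead0: "poly (coeff (bloch_poly V l) (2 * q2)) w \<noteq> 0 \<longleftrightarrow> w \<noteq> 0" for w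
    using c[of V l] q1_pos by (simp add: lead poly_monom)
  obtain w where w: "w \<noteq> 0" "\<forall>z. \<not> (poly (eval_coeffs w (bloch_poly V l)) z = 0 \<and>
     poly (pderiv (eval_coeffs w (bloch_poly V l))) z = 0)"
    using bloch_poly_squarefree_fibre by blast
  have "2 \<le> 2 * q2" using q2_pos by simp
  moreover have "poly (coeff (bloch_poly V l) (2 * q2)) w \<noteq> 0" using w(1) lead0 by blast
  moreover have "{z. poly (eval_coeffs w (bloch_poly V l)) z = 0 \<and>
     poly (pderiv (eval_coeffs w (bloch_poly V l))) z = 0} = {}" using w(2) by simp
  ultimately show ?thesis
    using card_double_roots_le[OF degree_bloch_poly _ degree_coeff_bloch_poly, of V l] by (simp add: lead0)
qed

end

section \<open>Perturbation of Hermitian matrices\<close>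

text \<open>Existence is enough: below, the derivatives of the cofactors are multiplied by matrix
  entries that vanish at the point.\<close>

lemma det_has_derivative_exists:
  fixes X :: "complex \<Rightarrow> complex mat"
  assumes c: "\<And>t. X t \<in> carrier_mat n n"
    and d: "\<And>i j. i < n \<Longrightarrow> j < n \<Longrightarrow> \<exists>D. ((\<lambda>t. X t $$ (i, j)) has_field_derivative D) (at t0)"
  shows "\<exists>D. ((\<lambda>t. det (X t)) has_field_derivative D) (at t0)"
proof -
  have prod: "\<exists>D. ((\<lambda>t. \<Prod>i\<in>S. f i t) has_field_derivative D) (at t0)"
    if "finite S" "\<And>i. i \<in> S \<Longrightarrow> \<exists>D. (f i has_field_derivative D) (at t0)"
    for S :: "nat set" and f :: "nat \<Rightarrow> complex \<Rightarrow> complex"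
    using that
  proof (induction S rule: finite_induct)
    case empty
    show ?case by (auto intro: DERIV_const)
  next
    case (insert x S)
    obtain D1 where "((\<lambda>t. \<Prod>i\<in>S. f i t) has_field_derivative D1) (at t0)" using insert by auto
    moreover obtain D2 where "(f x has_field_derivative D2) (at t0)" using insert by auto
    ultimately have "((\<lambda>t. f x t * (\<Prod>i\<in>S. f i t)) has_field_derivative
        D2 * (\<Prod>i\<in>S. f i t0) + D1 * f x t0) (at t0)" by (intro DERIV_mult)
    thus ?case using insert by auto
  qed
  have ex: "\<exists>D. ((\<lambda>t. \<Prod>i=0..<n. X t $$ (i, p i)) has_field_derivative D) (at t0)"
    if "p permutes {0..<n}" for p
    using permutes_in_image[OF that] by (intro prod) (auto intro!: d)
  define D where "D p = (SOME D. ((\<lambda>t. \<Prod>i=0..<n. X t $$ (i, p i)) has_field_derivative D) (at t0))" for p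
  have D: "((\<lambda>t. \<Prod>i=0..<n. X t $$ (i, p i)) has_field_derivative D p) (at t0)"
    if "p permutes {0..<n}" for p
    unfolding D_def by (rule someI_ex[OF ex[OF that]])
  have "((\<lambda>t. \<Sum>p | p permutes {0..<n}. signof p * (\<Prod>i=0..<n. X t $$ (i, p i))) has_field_derivative
      (\<Sum>p | p permutes {0..<n}. signof p * D p)) (at t0)"
    by (intro DERIV_sum DERIV_cmult D) auto
  thus ?thesis unfolding det_def'[OF c] by blast
qed

lemma det_zero_column:
  fixes A :: "'a::comm_ring_1 mat"
  assumes "A \<in> carrier_mat n n" "j < n" "\<And>i. i < n \<Longrightarrow> A $$ (i, j) = 0"
  shows "det A = 0"
  using laplace_expansion_column[OF assms(1,2)] assms(3) by simp

text \<open>In the Laplace expansion along row \<open>k\<close> only the diagonal cofactor survives at \<open>t\<^sub>0\<close>: the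
  minors of the other cofactors still contain the vanishing column \<open>k\<close>.\<close>

lemma det_has_derivative_cross:
  fixes X :: "complex \<Rightarrow> complex mat"
  assumes c: "\<And>t. X t \<in> carrier_mat n n" and k: "k < n"
    and d: "\<And>i j. i < n \<Longrightarrow> j < n \<Longrightarrow> ((\<lambda>t. X t $$ (i, j)) has_field_derivative E i j) (at t0)"
    and row: "\<And>j. j < n \<Longrightarrow> X t0 $$ (k, j) = 0" and col: "\<And>j. j < n \<Longrightarrow> X t0 $$ (j, k) = 0"
  shows "((\<lambda>t. det (X t)) has_field_derivative E k k * det (mat_delete (X t0) k k)) (at t0)"
proof -
  have "\<exists>D. ((\<lambda>t. cofactor (X t) k j) has_field_derivative D) (at t0)" if j: "j < n" for j
  proof -
    have "\<exists>D. ((\<lambda>t. det (mat_delete (X t) k j)) has_field_derivative D) (at t0)"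
    proof (rule det_has_derivative_exists)
      show "mat_delete (X t) k j \<in> carrier_mat (n - 1) (n - 1)" for t
        by (rule mat_delete_carrier[OF c])
      fix i j' assume ij: "i < n - 1" "j' < n - 1"
      let ?i = "if i < k then i else Suc i" and ?j = "if j' < j then j' else Suc j'"
      have "mat_delete (X t) k j $$ (i, j') = X t $$ (?i, ?j)" for t
        using ij c[of t] by (simp add: mat_delete_def)
      moreover have "((\<lambda>t. X t $$ (?i, ?j)) has_field_derivative E ?i ?j) (at t0)"
        using ij by (intro d) auto
      ultimately show "\<exists>D. ((\<lambda>t. mat_delete (X t) k j $$ (i, j')) has_field_derivative D) (at t0)"
        by auto
    qed
    then obtain D where "((\<lambda>t. det (mat_delete (X t) k j)) has_field_derivative D) (at t0)" ..
    thus ?thesis unfolding cofactor_def using DERIV_cmult by blast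
  qed
  then obtain F where F: "\<And>j. j < n \<Longrightarrow> ((\<lambda>t. cofactor (X t) k j) has_field_derivative F j) (at t0)"
    by metis
  have "((\<lambda>t. \<Sum>j<n. X t $$ (k, j) * cofactor (X t) k j) has_field_derivative
      (\<Sum>j<n. E k j * cofactor (X t0) k j + F j * X t0 $$ (k, j))) (at t0)"
    using k by (intro DERIV_sum DERIV_mult d F) auto
  also have "(\<Sum>j<n. E k j * cofactor (X t0) k j + F j * X t0 $$ (k, j)) =
      (\<Sum>j<n. if j = k then E k k * det (mat_delete (X t0) k k) else 0)"
  proof (intro sum.cong refl)
    fix j assume "j \<in> {..<n}"
    hence j: "j < n" by simp
    have "det (mat_delete (X t0) k j) = 0" if "j \<noteq> k"
    proof (rule det_zero_column)
      let ?k = "if k < j then k else k - 1"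
      show "mat_delete (X t0) k j \<in> carrier_mat (n - 1) (n - 1)" by (rule mat_delete_carrier[OF c])
      show k': "?k < n - 1" using j k that by auto
      fix i assume i: "i < n - 1"
      have "mat_delete (X t0) k j $$ (i, ?k) = X t0 $$ (if i < k then i else Suc i, k)"
        using i k' c[of t0] that by (auto simp: mat_delete_def)
      also have "\<dots> = 0" using i by (intro col) auto
      finally show "mat_delete (X t0) k j $$ (i, ?k) = 0" .
    qed
    thus "E k j * cofactor (X t0) k j + F j * X t0 $$ (k, j) =
        (if j = k then E k k * det (mat_delete (X t0) k k) else 0)"
      using row[OF j] by (simp add: cofactor_def)
  qed
  also have "\<dots> = E k k * det (mat_delete (X t0) k k)" using k by simp
  finally show ?thesis using laplace_expansion_row[OF c k] by simp
qed

definition hermitian_mat :: "nat \<Rightarrow> complex mat \<Rightarrow> bool" where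
  "hermitian_mat n A \<longleftrightarrow> A \<in> carrier_mat n n \<and> (\<forall>i<n. \<forall>j<n. A $$ (i, j) = cnj (A $$ (j, i)))"

text \<open>Take the identity with column \<open>k\<close> replaced by \<open>v\<close>, which is
  invertible because \<open>v k\<close> is nonzero, and its conjugate transpose. For a kernel vector
  of a Hermitian matrix the resulting congruence clears row \<open>k\<close> and column
  \<open>k\<close>.\<close>

lemma congruence_at_kernel_vector:
  fixes v :: "nat \<Rightarrow> complex"
  assumes k: "k < n" and vk: "v k \<noteq> 0"
  obtains C C' where "C \<in> carrier_mat n n" "C' \<in> carrier_mat n n" "det C \<noteq> 0" "det C' \<noteq> 0"
    "\<And>i. i < n \<Longrightarrow> C $$ (i, k) = v i" "\<And>i j. i < n \<Longrightarrow> j < n \<Longrightarrow> C' $$ (i, j) = cnj (C $$ (j, i))"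
proof -
  define C where "C = mat n n (\<lambda>(i, j). if j = k then v i else if i = j then 1 else 0)"
  define C' where "C' = mat n n (\<lambda>(i, j). cnj (C $$ (j, i)))"
  have C: "C \<in> carrier_mat n n" "C' \<in> carrier_mat n n" by (simp_all add: C_def C'_def)
  have "det C \<noteq> 0"
  proof
    assume "det C = 0"
    then obtain u where u: "u \<in> carrier_vec n" "u \<noteq> 0\<^sub>v n" "C *\<^sub>v u = 0\<^sub>v n"
      using det_0_iff_vec_prod_zero_field[OF C(1)] by blast
    have e: "(\<Sum>j<n. C $$ (i, j) * u $ j) = 0" if "i < n" for i
    proof -
      have "(C *\<^sub>v u) $ i = (\<Sum>j<n. C $$ (i, j) * u $ j)"
        using that u(1) by (simp add: C_def scalar_prod_def atLeast0LessThan)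
      thus ?thesis using u(3) that by simp
    qed
    have s: "(\<Sum>j<n. C $$ (i, j) * u $ j) = v i * u $ k + (if i = k then 0 else u $ i)" if i: "i < n" for i
    proof -
      have "(\<Sum>j<n. C $$ (i, j) * u $ j) =
          (\<Sum>j<n. (if j = k then v i * u $ k else 0) + (if j = i then (if i = k then 0 else u $ i) else 0))"
        using i by (intro sum.cong) (auto simp: C_def)
      thus ?thesis using i k by (simp add: sum.distrib)
    qed
    have uk: "u $ k = 0" using e[OF k] s[OF k] vk by simp
    have "u $ i = 0" if "i < n" for i using e[OF that] s[OF that] uk by (auto split: if_splits)
    hence "u = 0\<^sub>v n" using u(1) by (intro eq_vecI) auto
    with u(2) show False by simp
  qed
  moreover have "det C' = cnj (det C)"
  proof -
    have hom: "comm_ring_hom cnj" by unfold_locales auto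
    have "C' = map_mat cnj (transpose_mat C)" by (rule eq_matI) (auto simp: C'_def C_def)
    thus ?thesis using comm_ring_hom.hom_det[OF hom, of "transpose_mat C"] det_transpose[OF C(1)] by simp
  qed
  ultimately show ?thesis
    using k by (intro that[of C C'] C) (auto simp: C'_def C_def)
qed

lemma mult3_mat_index:
  fixes A B C :: "'a::comm_semiring_0 mat"
  assumes "A \<in> carrier_mat n n" "B \<in> carrier_mat n n" "C \<in> carrier_mat n n" "i < n" "j < n"
  shows "(A * B * C) $$ (i, j) = (\<Sum>b<n. \<Sum>a<n. A $$ (i, a) * B $$ (a, b) * C $$ (b, j))"
  using assms
  by (simp add: scalar_prod_def atLeast0LessThan sum_distrib_left mult.assoc) (rule sum.swap)

text \<open>After the congruence with a kernel vector \<open>v\<close>, the derivative of the determinant in every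
  direction is a multiple of one and the same minor. For the direction of the identity the factor is
  \<open>|v|\<^sup>2 \<noteq> 0\<close>, so a multiple eigenvalue makes this minor vanish.\<close>

lemma det_perturbation_multiple_eigenvalue:
  fixes X :: "complex \<Rightarrow> complex mat"
  assumes B: "hermitian_mat n B" and det0: "det B = 0"
    and mult: "((\<lambda>x. det (B + x \<cdot>\<^sub>m 1\<^sub>m n)) has_field_derivative 0) (at 0)"
    and X: "\<And>t. X t \<in> carrier_mat n n" "X t0 = B"
    and d: "\<And>i j. i < n \<Longrightarrow> j < n \<Longrightarrow> \<exists>D. ((\<lambda>t. X t $$ (i, j)) has_field_derivative D) (at t0)"
  shows "((\<lambda>t. det (X t)) has_field_derivative 0) (at t0)"
proof -
  have Bc: "B \<in> carrier_mat n n" and herm: "\<And>i j. i < n \<Longrightarrow> j < n \<Longrightarrow> B $$ (i, j) = cnj (B $$ (j, i))"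
    using B unfolding hermitian_mat_def by blast+
  obtain v where v: "v \<in> carrier_vec n" "v \<noteq> 0\<^sub>v n" "B *\<^sub>v v = 0\<^sub>v n"
    using det0 det_0_iff_vec_prod_zero_field[OF Bc] by blast
  have "\<exists>k<n. v $ k \<noteq> 0"
  proof (rule ccontr)
    assume "\<not> (\<exists>k<n. v $ k \<noteq> 0)"
    hence "v = 0\<^sub>v n" using v(1) by (intro eq_vecI) auto
    with v(2) show False by simp
  qed
  then obtain k where k: "k < n" "v $ k \<noteq> 0" by blast
  have Bv: "(\<Sum>j<n. B $$ (i, j) * v $ j) = 0" if "i < n" for i
  proof -
    have "(B *\<^sub>v v) $ i = (\<Sum>j<n. B $$ (i, j) * v $ j)"
      using that v(1) Bc by (simp add: scalar_prod_def atLeast0LessThan)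
    thus ?thesis using v(3) that by simp
  qed
  \<comment> \<open>Hermitian symmetry turns the right kernel vector into a left one.\<close>
  have vB: "(\<Sum>i<n. cnj (v $ i) * B $$ (i, j)) = 0" if j: "j < n" for j
  proof -
    have "(\<Sum>i<n. cnj (v $ i) * B $$ (i, j)) = cnj (\<Sum>i<n. B $$ (j, i) * v $ i)"
      unfolding cnj_sum
    proof (intro sum.cong refl)
      fix i assume "i \<in> {..<n}"
      thus "cnj (v $ i) * B $$ (i, j) = cnj (B $$ (j, i) * v $ i)"
        using herm[OF _ j, of i] by (simp only: complex_cnj_mult mult.commute lessThan_iff)
    qed
    thus ?thesis using Bv[OF j] by simp
  qed
  obtain C C' where C: "C \<in> carrier_mat n n" "C' \<in> carrier_mat n n" "det C \<noteq> 0" "det C' \<noteq> 0"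
    "\<And>i. i < n \<Longrightarrow> C $$ (i, k) = v $ i" "\<And>i j. i < n \<Longrightarrow> j < n \<Longrightarrow> C' $$ (i, j) = cnj (C $$ (j, i))"
    using congruence_at_kernel_vector[where v = "\<lambda>i. v $ i", OF k] by metis
  have cross: "((\<lambda>t. det C' * det (Y t) * det C) has_field_derivative
      (\<Sum>b<n. \<Sum>a<n. cnj (v $ a) * E a b * v $ b) * det (mat_delete (C' * B * C) k k)) (at s0)"
    if Y: "\<And>t. Y t \<in> carrier_mat n n" "Y s0 = B"
      and dY: "\<And>i j. i < n \<Longrightarrow> j < n \<Longrightarrow> ((\<lambda>t. Y t $$ (i, j)) has_field_derivative E i j) (at s0)"
    for Y :: "complex \<Rightarrow> complex mat" and E s0
  proof -
    let ?E = "\<lambda>i j. \<Sum>b<n. \<Sum>a<n. C' $$ (i, a) * E a b * C $$ (b, j)"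
    have "((\<lambda>t. det (C' * Y t * C)) has_field_derivative ?E k k * det (mat_delete (C' * Y s0 * C) k k)) (at s0)"
    proof (rule det_has_derivative_cross[where n = n and E = ?E])
      show "C' * Y t * C \<in> carrier_mat n n" for t
        using C(1,2) Y(1)[of t] by (intro mult_carrier_mat)
      show "k < n" by (rule k)
      show "((\<lambda>t. (C' * Y t * C) $$ (i, j)) has_field_derivative ?E i j) (at s0)"
        if ij: "i < n" "j < n" for i j
        unfolding mult3_mat_index[OF C(2) Y(1) C(1) ij]
        by (intro DERIV_sum DERIV_cmult DERIV_cmult_right dY) auto
      fix j assume j: "j < n"
      have "(C' * B * C) $$ (k, j) = (\<Sum>b<n. (\<Sum>a<n. cnj (v $ a) * B $$ (a, b)) * C $$ (b, j))"
        using C k by (simp add: mult3_mat_index[OF C(2) Bc C(1) k(1) j] sum_distrib_right)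
      thus "(C' * Y s0 * C) $$ (k, j) = 0" using vB by (simp add: Y(2))
      have "(C' * B * C) $$ (j, k) = (\<Sum>b<n. \<Sum>a<n. C' $$ (j, a) * B $$ (a, b) * v $ b)"
        using C k by (simp add: mult3_mat_index[OF C(2) Bc C(1) j k(1)])
      also have "\<dots> = (\<Sum>a<n. C' $$ (j, a) * (\<Sum>b<n. B $$ (a, b) * v $ b))"
        by (subst sum.swap) (simp add: sum_distrib_left mult.assoc)
      finally show "(C' * Y s0 * C) $$ (j, k) = 0" using Bv by (simp add: Y(2))
    qed
    moreover have "det (C' * Y t * C) = det C' * det (Y t) * det C" for t
      using C(1,2) Y(1)[of t] by (simp add: det_mult[where n = n])
    ultimately show ?thesis using C k by (simp add: Y(2))
  qed
  have mc: "B + x \<cdot>\<^sub>m 1\<^sub>m n \<in> carrier_mat n n" for x using Bc by simp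
  let ?I = "\<lambda>a b. if a = b then 1 else (0::complex)"
  have "((\<lambda>x. det C' * det (B + x \<cdot>\<^sub>m 1\<^sub>m n) * det C) has_field_derivative
      (\<Sum>b<n. \<Sum>a<n. cnj (v $ a) * ?I a b * v $ b) * det (mat_delete (C' * B * C) k k)) (at 0)"
  proof (rule cross[OF mc])
    show "B + 0 \<cdot>\<^sub>m 1\<^sub>m n = B" using Bc by (intro eq_matI) auto
    fix i j assume ij: "i < n" "j < n"
    have "(B + x \<cdot>\<^sub>m 1\<^sub>m n) $$ (i, j) = B $$ (i, j) + x * ?I i j" for x using ij Bc by simp
    moreover have "((\<lambda>x. B $$ (i, j) + x * ?I i j) has_field_derivative ?I i j) (at 0)"
      by (auto intro!: derivative_eq_intros)
    ultimately show "((\<lambda>x. (B + x \<cdot>\<^sub>m 1\<^sub>m n) $$ (i, j)) has_field_derivative ?I i j) (at 0)" by simp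
  qed
  moreover have "((\<lambda>x. det C' * det (B + x \<cdot>\<^sub>m 1\<^sub>m n) * det C) has_field_derivative det C' * 0 * det C) (at 0)"
    by (intro DERIV_cmult DERIV_cmult_right mult)
  ultimately have prod0: "(\<Sum>b<n. \<Sum>a<n. cnj (v $ a) * ?I a b * v $ b) * det (mat_delete (C' * B * C) k k) = 0"
    using DERIV_unique by fastforce
  define S where "S = (\<Sum>b<n. (norm (v $ b))\<^sup>2)"
  have "(\<Sum>b<n. \<Sum>a<n. cnj (v $ a) * ?I a b * v $ b) = of_real S"
  proof -
    have "(\<Sum>a<n. cnj (v $ a) * ?I a b * v $ b) = of_real ((norm (v $ b))\<^sup>2)" if "b < n" for b
    proof -
      have "(\<Sum>a<n. cnj (v $ a) * ?I a b * v $ b) = (\<Sum>a<n. if a = b then cnj (v $ b) * v $ b else 0)"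
        by (intro sum.cong) auto
      also have "\<dots> = v $ b * cnj (v $ b)" using that by simp
      finally show ?thesis by (simp only: complex_norm_square)
    qed
    thus ?thesis by (simp add: S_def)
  qed
  with prod0 have "of_real S * det (mat_delete (C' * B * C) k k) = 0" by (simp only:)
  moreover have "S > 0"
    unfolding S_def using k by (intro sum_pos2[of _ k]) auto
  ultimately have minor: "det (mat_delete (C' * B * C) k k) = 0"
    by simp
  obtain E where E: "\<And>i j. i < n \<Longrightarrow> j < n \<Longrightarrow> ((\<lambda>t. X t $$ (i, j)) has_field_derivative E i j) (at t0)"
    using d by metis
  have "((\<lambda>t. det C' * det (X t) * det C) has_field_derivative 0) (at t0)"
    using cross[OF X E] minor by simp
  hence "((\<lambda>t. inverse (det C' * det C) * (det C' * det (X t) * det C)) has_field_derivative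
      inverse (det C' * det C) * 0) (at t0)" by (rule DERIV_cmult)
  moreover have "inverse (det C' * det C) * (det C' * det (X t) * det C) = det (X t)" for t
    using C(3,4) by (simp add: field_simps)
  ultimately show ?thesis by (simp only: mult_zero_right)
qed

section \<open>Continuity of ordered real roots\<close>

text \<open>Induction on the number of coordinates: each new coordinate has a monotone, bounded
  subsequence, and passing to it preserves the earlier limits.\<close>

lemma simultaneously_convergent_subseq:
  fixes L :: "nat \<Rightarrow> nat \<Rightarrow> real"
  assumes "\<And>n j. j < N \<Longrightarrow> \<bar>L n j\<bar> \<le> K"
  shows "\<exists>r. strict_mono r \<and> (\<forall>j<N. convergent (\<lambda>n. L (r n) j))"
  using assms
proof (induction N)
  case 0
  show ?case by (auto intro: exI[of _ id] strict_mono_id)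
next
  case (Suc N)
  then obtain r where r: "strict_mono r" "\<forall>j<N. convergent (\<lambda>n. L (r n) j)" by auto
  obtain s where s: "strict_mono s" "monoseq (\<lambda>n. L (r (s n)) N)"
    using seq_monosub[of "\<lambda>n. L (r n) N"] by auto
  have "Bseq (\<lambda>n. L (r (s n)) N)" using Suc.prems by (intro BseqI'[of _ K]) auto
  hence "convergent (\<lambda>n. L (r (s n)) N)" using s(2) by (rule Bseq_monoseq_convergent)
  moreover have "convergent (\<lambda>n. L (r (s n)) j)" if "j < N" for j
    using convergent_subseq_convergent[OF r(2)[rule_format, OF that] s(1)] by (simp add: o_def)
  ultimately show ?case
    using r(1) s(1) by (intro exI[of _ "r \<circ> s"]) (auto simp: less_Suc_eq strict_mono_def)
qed

text \<open>A monic polynomial determines the multiset of its roots, and a sorted list is determined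
  by its multiset.\<close>

lemma sorted_roots_unique:
  fixes l m :: "nat \<Rightarrow> real"
  assumes e: "\<And>\<mu>. (\<Prod>j<N. \<mu> - l j) = (\<Prod>j<N. \<mu> - m j)"
    and l: "\<And>i j. i \<le> j \<Longrightarrow> j < N \<Longrightarrow> l i \<le> l j" and m: "\<And>i j. i \<le> j \<Longrightarrow> j < N \<Longrightarrow> m i \<le> m j"
    and j: "j < N"
  shows "l j = m j"
proof -
  have pr: "proots (\<Prod>j<N. [:- f j, 1:]) = mset (map f [0..<N])" for f :: "nat \<Rightarrow> real"
  proof -
    have "proots (\<Prod>j<N. [:- f j, 1:]) = (\<Sum>j<N. {#f j#})" by (subst proots_prod) auto
    also have "\<dots> = mset (map f [0..<N])" by (induction N) simp_all
    finally show ?thesis .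
  qed
  have "poly (\<Prod>j<N. [:- l j, 1:]) = poly (\<Prod>j<N. [:- m j, 1:])"
    using e by (simp add: fun_eq_iff poly_prod)
  hence "(\<Prod>j<N. [:- l j, 1:]) = (\<Prod>j<N. [:- m j, 1:])" by (simp only: poly_eq_poly_eq_iff)
  hence "mset (map l [0..<N]) = mset (map m [0..<N])" using pr by metis
  moreover have "sorted (map l [0..<N])" "sorted (map m [0..<N])"
    using l m by (auto simp: sorted_iff_nth_mono)
  ultimately have "map l [0..<N] = map m [0..<N]"
    by (metis properties_for_sort)
  thus ?thesis using j by (metis nth_map_upt add_0 diff_zero)
qed

text \<open>A compactness argument: if convergence failed, a subsequence staying away from
  \<open>m j\<close> would have a further subsequence converging in all coordinates. Its limit would
  be a sorted list of roots of the same polynomial, hence equal to \<open>m\<close>.\<close>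

lemma sorted_roots_LIMSEQ:
  fixes L :: "nat \<Rightarrow> nat \<Rightarrow> real" and m :: "nat \<Rightarrow> real"
  assumes bd: "\<And>n j. j < N \<Longrightarrow> \<bar>L n j\<bar> \<le> K"
    and L: "\<And>n i j. i \<le> j \<Longrightarrow> j < N \<Longrightarrow> L n i \<le> L n j" and m: "\<And>i j. i \<le> j \<Longrightarrow> j < N \<Longrightarrow> m i \<le> m j"
    and lim: "\<And>\<mu>. (\<lambda>n. \<Prod>j<N. \<mu> - L n j) \<longlonglongrightarrow> (\<Prod>j<N. \<mu> - m j)"
    and j: "j < N"
  shows "(\<lambda>n. L n j) \<longlonglongrightarrow> m j"
proof (rule ccontr)
  assume "\<not> (\<lambda>n. L n j) \<longlonglongrightarrow> m j"
  then obtain \<epsilon> where \<epsilon>: "\<epsilon> > 0" "\<And>n0. \<exists>n\<ge>n0. \<bar>L n j - m j\<bar> \<ge> \<epsilon>"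
    by (auto simp: LIMSEQ_def dist_real_def not_less)
  have inf: "infinite {n. \<bar>L n j - m j\<bar> \<ge> \<epsilon>}"
    unfolding infinite_nat_iff_unbounded_le using \<epsilon>(2) by auto
  define r where "r = enumerate {n. \<bar>L n j - m j\<bar> \<ge> \<epsilon>}"
  have r: "strict_mono r" "\<And>n. \<bar>L (r n) j - m j\<bar> \<ge> \<epsilon>"
    using strict_mono_enumerate[OF inf] enumerate_in_set[OF inf] by (auto simp: r_def)
  obtain s where s: "strict_mono s" "\<And>i. i < N \<Longrightarrow> convergent (\<lambda>n. L (r (s n)) i)"
    using simultaneously_convergent_subseq[of N "\<lambda>n. L (r n)" K] bd by auto
  define l where "l i = lim (\<lambda>n. L (r (s n)) i)" for i
  have l: "(\<lambda>n. L (r (s n)) i) \<longlonglongrightarrow> l i" if "i < N" for i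
    using s(2)[OF that] by (simp add: convergent_LIMSEQ_iff l_def)
  have "l j = m j"
  proof (rule sorted_roots_unique[OF _ _ m j])
    fix \<mu>
    have "(\<lambda>n. \<Prod>j<N. \<mu> - L (r (s n)) j) \<longlonglongrightarrow> (\<Prod>j<N. \<mu> - l j)"
      by (intro tendsto_intros l) auto
    moreover have "(\<lambda>n. \<Prod>j<N. \<mu> - L (r (s n)) j) \<longlonglongrightarrow> (\<Prod>j<N. \<mu> - m j)"
      using LIMSEQ_subseq_LIMSEQ[OF lim[of \<mu>] strict_mono_o[OF r(1) s(1)]] by (simp add: o_def)
    ultimately show "(\<Prod>j<N. \<mu> - l j) = (\<Prod>j<N. \<mu> - m j)" by (rule LIMSEQ_unique)
  next
    fix i i' assume "i \<le> i'" "i' < N"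
    thus "l i \<le> l i'" using l[of i] l[of i'] L by (intro LIMSEQ_le[of _ "l i" _ "l i'"]) auto
  qed
  hence "(\<lambda>n. \<bar>L (r (s n)) j - m j\<bar>) \<longlonglongrightarrow> 0"
    using tendsto_rabs[OF tendsto_diff[OF l[OF j] tendsto_const[of "m j"]]] by simp
  hence "\<epsilon> \<le> 0" using r(2) by (intro LIMSEQ_le_const) auto
  with \<epsilon>(1) show False by simp
qed

section \<open>Eigenvalues of the Floquet-Bloch matrix\<close>

text \<open>The root is real because the quadratic form of \<open>A\<close> at an eigenvector equals
  its own conjugate. The bound comes from the row in which the eigenvector has its largest entry,
  and it makes the compactness argument for the roots applicable.\<close>

lemma hermitian_eigenvalue:
  assumes A: "hermitian_mat n A" and x: "poly (char_poly A) x = 0"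
  shows "Im x = 0" "norm x \<le> (\<Sum>i<n. \<Sum>j<n. norm (A $$ (i, j)))"
proof -
  have Ac: "A \<in> carrier_mat n n" and herm: "\<And>i j. i < n \<Longrightarrow> j < n \<Longrightarrow> A $$ (i, j) = cnj (A $$ (j, i))"
    using A unfolding hermitian_mat_def by blast+
  obtain v where v: "v \<in> carrier_vec n" "v \<noteq> 0\<^sub>v n" "A *\<^sub>v v = x \<cdot>\<^sub>v v"
    using x eigenvalue_root_char_poly[OF Ac] Ac by (auto simp: eigenvalue_def eigenvector_def)
  have Av: "(\<Sum>j<n. A $$ (i, j) * v $ j) = x * v $ i" if "i < n" for i
  proof -
    have "(A *\<^sub>v v) $ i = (\<Sum>j<n. A $$ (i, j) * v $ j)"
      using that v(1) Ac by (simp add: scalar_prod_def atLeast0LessThan)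
    thus ?thesis using v that by simp
  qed
  have "\<exists>k<n. v $ k \<noteq> 0"
  proof (rule ccontr)
    assume "\<not> (\<exists>k<n. v $ k \<noteq> 0)"
    hence "v = 0\<^sub>v n" using v(1) by (intro eq_vecI) auto
    with v(2) show False by simp
  qed
  then obtain k0 where k0: "k0 < n" "v $ k0 \<noteq> 0" by blast
  define s where "s = (\<Sum>i<n. \<Sum>j<n. cnj (v $ i) * A $$ (i, j) * v $ j)"
  define N where "N = (\<Sum>i<n. (norm (v $ i))\<^sup>2)"
  have N: "N > 0" unfolding N_def using k0 by (intro sum_pos2[of _ k0]) auto
  have "s = (\<Sum>i<n. cnj (v $ i) * (x * v $ i))"
    unfolding s_def by (intro sum.cong refl) (simp add: mult.assoc flip: sum_distrib_left Av)
  also have "\<dots> = (\<Sum>i<n. x * of_real ((norm (v $ i))\<^sup>2))"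
    by (intro sum.cong refl) (simp only: complex_norm_square mult_ac)
  also have "\<dots> = x * of_real N" by (simp add: N_def sum_distrib_left)
  finally have sN: "s = x * of_real N" .
  have "cnj s = (\<Sum>i<n. \<Sum>j<n. cnj (v $ j) * A $$ (j, i) * v $ i)"
    unfolding s_def cnj_sum
  proof (intro sum.cong refl)
    fix i j assume "i \<in> {..<n}" "j \<in> {..<n}"
    thus "cnj (cnj (v $ i) * A $$ (i, j) * v $ j) = cnj (v $ j) * A $$ (j, i) * v $ i"
      using herm[of j i] by (simp only: complex_cnj_mult complex_cnj_cnj mult_ac lessThan_iff)
  qed
  also have "\<dots> = s" unfolding s_def by (rule sum.swap)
  finally have "cnj x * of_real N = x * of_real N" by (simp add: sN)
  hence "cnj x = x" using N by simp
  thus "Im x = 0" by (simp add: complex_eq_iff)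
  obtain k where k: "k < n" "\<And>j. j < n \<Longrightarrow> norm (v $ j) \<le> norm (v $ k)"
  proof -
    have fin: "finite ((\<lambda>j. norm (v $ j)) ` {..<n})" "(\<lambda>j. norm (v $ j)) ` {..<n} \<noteq> {}"
      using k0 by auto
    obtain k where "k \<in> {..<n}" "Max ((\<lambda>j. norm (v $ j)) ` {..<n}) = norm (v $ k)"
      using Max_in[OF fin] by auto
    thus ?thesis using that[of k] Max_ge[OF fin(1)] by auto
  qed
  have vk: "norm (v $ k) > 0" using k(2)[OF k0(1)] k0(2) by (auto intro: less_le_trans)
  have "norm x * norm (v $ k) = norm (\<Sum>j<n. A $$ (k, j) * v $ j)" by (simp add: Av[OF k(1)] norm_mult)
  also have "\<dots> \<le> (\<Sum>j<n. norm (A $$ (k, j)) * norm (v $ k))"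
    using k(2) by (intro sum_norm_le) (simp add: norm_mult mult_left_mono)
  also have "\<dots> = (\<Sum>j<n. norm (A $$ (k, j))) * norm (v $ k)" by (simp add: sum_distrib_right)
  finally have "norm x \<le> (\<Sum>j<n. norm (A $$ (k, j)))" using vk by simp
  also have "\<dots> \<le> (\<Sum>i<n. \<Sum>j<n. norm (A $$ (i, j)))"
    using k(1) by (intro member_le_sum) (auto intro: sum_nonneg)
  finally show "norm x \<le> (\<Sum>i<n. \<Sum>j<n. norm (A $$ (i, j)))" .
qed

definition eigvals :: "complex mat \<Rightarrow> real list" where
  "eigvals A = sorted_list_of_multiset (image_mset Re (proots (char_poly A)))"

lemma hermitian_eigvals:
  assumes A: "hermitian_mat n A"
  shows "length (eigvals A) = n" "sorted (eigvals A)"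
    "char_poly A = (\<Prod>j<n. [:- complex_of_real (eigvals A ! j), 1:])"
    "j < n \<Longrightarrow> \<bar>eigvals A ! j\<bar> \<le> (\<Sum>i<n. \<Sum>j<n. norm (A $$ (i, j)))"
proof -
  have Ac: "A \<in> carrier_mat n n" using A by (simp add: hermitian_mat_def)
  have p: "degree (char_poly A) = n" "lead_coeff (char_poly A) = 1"
    using degree_monic_char_poly[OF Ac] by auto
  have ms: "mset (eigvals A) = image_mset Re (proots (char_poly A))" by (simp add: eigvals_def)
  show len: "length (eigvals A) = n"
    using ms p(1) by (metis size_mset size_image_mset size_proots_complex)
  show "sorted (eigvals A)" by (simp add: eigvals_def)
  have p0: "char_poly A \<noteq> 0" using p(2) by auto
  \<comment> \<open>Taking real parts loses nothing, since all roots are real; the multiset of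
    complex roots is recovered with multiplicities.\<close>
  have "image_mset complex_of_real (mset (eigvals A)) = image_mset (\<lambda>x. x) (proots (char_poly A))"
    unfolding ms image_mset.compositionality
    using hermitian_eigenvalue(1)[OF A] p0 by (intro image_mset_cong) (simp add: complex_eq_iff)
  hence pr: "proots (char_poly A) = image_mset complex_of_real (mset (eigvals A))" by simp
  have "char_poly A = (\<Prod>x\<in>#proots (char_poly A). [:-x, 1:])"
    using complex_poly_decompose_multiset[of "char_poly A"] p(2) by simp
  also have "\<dots> = (\<Prod>x\<leftarrow>eigvals A. [:- complex_of_real x, 1:])"
    by (simp add: pr image_mset.compositionality o_def prod_mset_prod_list flip: mset_map)
  also have "\<dots> = (\<Prod>j<n. [:- complex_of_real (eigvals A ! j), 1:])"
    by (simp add: prod.list_conv_set_nth len atLeast0LessThan)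
  finally show cp: "char_poly A = (\<Prod>j<n. [:- complex_of_real (eigvals A ! j), 1:])" .
  assume j: "j < n"
  hence "poly (char_poly A) (complex_of_real (eigvals A ! j)) = 0"
    by (subst cp) (auto simp: poly_prod intro!: prod_zero bexI[of _ j])
  from hermitian_eigenvalue(2)[OF A this]
  show "\<bar>eigvals A ! j\<bar> \<le> (\<Sum>i<n. \<Sum>j<n. norm (A $$ (i, j)))" by simp
qed

lemma det_minus_smult_one:
  fixes A :: "'a::field mat"
  assumes A: "A \<in> carrier_mat n n"
  shows "det (A - y \<cdot>\<^sub>m 1\<^sub>m n) = (- 1) ^ n * poly (char_poly A) y"
proof -
  have "A - y \<cdot>\<^sub>m 1\<^sub>m n = (- 1) \<cdot>\<^sub>m (- char_matrix A y)"
    using A by (intro eq_matI) (auto simp: char_matrix_def)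
  thus ?thesis using A by (simp add: char_poly_matrix[OF A] char_matrix_def)
qed

lemma poly_pderiv_prod_multiple_root:
  fixes r :: "nat \<Rightarrow> 'a::idom"
  assumes "i < n" "j < n" "i \<noteq> j" "r i = x" "r j = x"
  shows "poly (pderiv (\<Prod>k<n. [:- r k, 1:])) x = 0"
proof -
  have "(\<Prod>k<n. [:- r k, 1:]) = [:- r i, 1:] * ([:- r j, 1:] * (\<Prod>k\<in>{..<n} - {i} - {j}. [:- r k, 1:]))"
    using assms by (subst prod.remove[of _ i], simp, simp, subst prod.remove[of _ j]) auto
  thus ?thesis using assms by (simp add: pderiv_mult del: mult_pCons_left)
qed

context period_cell
begin

lemma fb_idx_translate:
  assumes i: "i < q1 * q2"
    and n: "n = (fst (fb_pt q1 i) + int q1 * a, snd (fb_pt q1 i) + int q2 * b)"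
  shows "fb_idx q1 q2 n = i" "wind1 n = a" "wind2 n = b"
proof -
  have e: "fst n - 1 = (fst (fb_pt q1 i) - 1) + int q1 * a" "snd n - 1 = (snd (fb_pt q1 i) - 1) + int q2 * b"
    by (simp_all add: n)
  have "(fst n - 1) mod int q1 = int (i mod q1)" "(snd n - 1) mod int q2 = int (i div q1)"
    unfolding e using fb_pt_mod_div[OF i] by simp_all
  thus "fb_idx q1 q2 n = i" by (simp add: fb_idx_def)
  show "wind1 n = a" "wind2 n = b"
    unfolding wind1_def wind2_def e using fb_pt_mod_div[OF i] q1_pos q2_pos by simp_all
qed

text \<open>The reversed step returns to the original site with opposite winding numbers. This is
  the combinatorial source of Hermitian symmetry.\<close>

lemma move_reverse:
  assumes i: "i < q1 * q2" and j: "fb_idx q1 q2 (move i d) = j"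
  shows "fb_idx q1 q2 (move j (- fst d, - snd d)) = i" "wind1 (move j (- fst d, - snd d)) = - wind1 (move i d)"
    "wind2 (move j (- fst d, - snd d)) = - wind2 (move i d)"
proof -
  have "move j (- fst d, - snd d) = (fst (fb_pt q1 i) + int q1 * (- wind1 (move i d)),
      snd (fb_pt q1 i) + int q2 * (- wind2 (move i d)))"
    using winding_decomp[of "move i d"] j by (simp add: move_def)
  from fb_idx_translate[OF i this]
  show "fb_idx q1 q2 (move j (- fst d, - snd d)) = i" "wind1 (move j (- fst d, - snd d)) = - wind1 (move i d)"
    "wind2 (move j (- fst d, - snd d)) = - wind2 (move i d)" .
qed

lemma cnj_power_int_unit: "norm z = 1 \<Longrightarrow> cnj z powi a = z powi (- a)" for z :: complex
proof -
  assume z: "norm z = 1"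
  have "z * cnj z = 1" using z complex_norm_square[of z] by simp
  hence "cnj z = inverse z" using z by (metis inverse_unique)
  thus ?thesis by (simp add: power_int_minus power_int_inverse)
qed

lemma hermitian_bloch_mat:
  assumes z: "norm z = 1" and w: "norm w = 1"
  shows "hermitian_mat (q1 * q2) (bloch_mat V (complex_of_real l) z w)"
  unfolding hermitian_mat_def
proof (intro conjI allI impI bloch_mat_carrier)
  fix i j assume i: "i < q1 * q2" and j: "j < q1 * q2"
  let ?l = "complex_of_real l"
  let ?t = "\<lambda>i j d. if fb_idx q1 q2 (move i d) = j
     then weight V ?l i d * z powi wind1 (move i d) * w powi wind2 (move i d) else 0"
  have inv: "(\<lambda>d. (- fst d, - snd d)) ` steps = steps" by (auto simp: steps_def)
  have "cnj (bloch_mat V ?l z w $$ (j, i)) = (\<Sum>d\<in>steps. cnj (?t j i d))"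
    using i j by (simp add: bloch_mat_def)
  \<comment> \<open>The step \<open>d\<close> from \<open>i\<close> to \<open>j\<close> is matched
    with its reverse, and on the unit circle conjugation inverts the powers of \<open>z\<close> and
    \<open>w\<close>.\<close>
  also have "\<dots> = (\<Sum>d\<in>steps. cnj (?t j i (- fst d, - snd d)))"
    by (subst inv[symmetric], subst sum.reindex) (auto simp: inj_on_def)
  also have "\<dots> = (\<Sum>d\<in>steps. ?t i j d)"
  proof (intro sum.cong refl)
    fix d :: "int \<times> int"
    have d0: "(- fst d, - snd d) = (0, 0) \<longleftrightarrow> d = (0, 0)" by (cases d) auto
    show "cnj (?t j i (- fst d, - snd d)) = ?t i j d"
    proof (cases "fb_idx q1 q2 (move i d) = j")
      case True
      note r = move_reverse[OF i True]
      have "weight V ?l j (- fst d, - snd d) = weight V ?l i d"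
      proof (cases "d = (0, 0)")
        case True
        hence "i = j" using \<open>fb_idx q1 q2 (move i d) = j\<close> fb_idx_fb_pt[OF i] by simp
        thus ?thesis using True by (simp add: weight_def d0)
      qed (auto simp: weight_def prod_eq_iff)
      moreover have "cnj (weight V ?l i d) = weight V ?l i d" by (simp add: weight_def)
      ultimately show ?thesis
        using True r by (simp add: cnj_power_int_unit z w)
    next
      case False
      have "fb_idx q1 q2 (move j (- fst d, - snd d)) \<noteq> i"
      proof
        assume "fb_idx q1 q2 (move j (- fst d, - snd d)) = i"
        from move_reverse(1)[OF j this] False show False by simp
      qed
      thus ?thesis using False by simp
    qed
  qed
  also have "\<dots> = bloch_mat V ?l z w $$ (i, j)" using i j by (simp add: bloch_mat_def)
  finally show "bloch_mat V ?l z w $$ (i, j) = cnj (bloch_mat V ?l z w $$ (j, i))" by simp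
qed

lemma D_V_carrier: "D_V q1 q2 V k \<in> carrier_mat (q1 * q2) (q1 * q2)"
  by (simp add: D_V_def)

lemma D_V_eq_bloch_mat:
  "D_V q1 q2 V k = bloch_mat V 0 (cis (2 * pi * fst k)) (cis (2 * pi * snd k))"
  unfolding bloch_mat_D_V using D_V_carrier[of V k] by (intro eq_matI) auto

lemma hermitian_D_V: "hermitian_mat (q1 * q2) (D_V q1 q2 V k)"
  unfolding D_V_eq_bloch_mat using hermitian_bloch_mat[where l = 0] by simp

text \<open>The bound does not depend on the phases, so it bounds the eigenvalues uniformly in
  \<open>k\<close>.\<close>

lemma norm_bloch_mat_le:
  assumes z: "norm z = 1" and w: "norm w = 1" and i: "i < q1 * q2" "j < q1 * q2"
  shows "norm (bloch_mat V l z w $$ (i, j)) \<le> (\<Sum>d\<in>steps. norm (weight V l i d))"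
proof -
  have "norm (z powi a) = 1" "norm (w powi a) = 1" for a
    using z w by (simp_all add: power_int_def norm_power norm_inverse)
  thus ?thesis using i unfolding bloch_mat_def
    by (auto intro!: sum_norm_le simp: norm_mult)
qed

lemma bloch_mat_has_derivative_exists:
  assumes "z0 \<noteq> 0" "i < q1 * q2" "j < q1 * q2"
  shows "\<exists>D. ((\<lambda>z. bloch_mat V l z w $$ (i, j)) has_field_derivative D) (at z0)"
proof -
  have "\<exists>D. ((\<lambda>z. if fb_idx q1 q2 (move i d) = j
     then weight V l i d * z powi wind1 (move i d) * w powi wind2 (move i d) else 0)
     has_field_derivative D) (at z0)" for d
    using assms(1) by (cases "fb_idx q1 q2 (move i d) = j")
      (auto intro!: exI derivative_eq_intros)
  then obtain D where "\<And>d. ((\<lambda>z. if fb_idx q1 q2 (move i d) = j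
     then weight V l i d * z powi wind1 (move i d) * w powi wind2 (move i d) else 0)
     has_field_derivative D d) (at z0)" by metis
  hence "((\<lambda>z. \<Sum>d\<in>steps. if fb_idx q1 q2 (move i d) = j
     then weight V l i d * z powi wind1 (move i d) * w powi wind2 (move i d) else 0)
     has_field_derivative (\<Sum>d\<in>steps. D d)) (at z0)" by (intro DERIV_sum) auto
  thus ?thesis using assms by (auto simp: bloch_mat_def)
qed

end

section \<open>From band extrema to double roots\<close>

text \<open>Near \<open>t0\<close> the factors other than \<open>j0\<close> keep their sign by
  continuity, and factor \<open>j0\<close> keeps its sign by extremality. Up to a constant sign, the
  product therefore has a local minimum with value 0.\<close>

lemma root_product_stationary:
  fixes L :: "real \<Rightarrow> nat \<Rightarrow> real"
  assumes lim: "\<And>j. j < n \<Longrightarrow> (\<lambda>t. L t j) \<midarrow>t0\<rightarrow> L t0 j"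
    and j0: "j0 < n" and ne: "\<And>j. j < n \<Longrightarrow> j \<noteq> j0 \<Longrightarrow> L t0 j \<noteq> c" and eq: "L t0 j0 = c"
    and ext: "(\<forall>t. L t j0 \<le> c) \<or> (\<forall>t. c \<le> L t j0)"
    and D: "((\<lambda>t. \<Prod>j<n. c - L t j) has_field_derivative d) (at t0)"
  shows "d = 0"
proof -
  define s :: "nat \<Rightarrow> real" where "s j = (if j = j0 then (if \<forall>t. L t j0 \<le> c then 1 else -1) else sgn (c - L t0 j))" for j
  have s0: "s j \<noteq> 0" if "j < n" for j using ne[OF that] by (auto simp: s_def sgn_eq_0_iff)
  have nn: "\<forall>\<^sub>F t in at t0. 0 \<le> s j * (c - L t j)" if j: "j < n" for j
  proof (cases "j = j0")
    case True
    have "0 \<le> s j * (c - L t j)" for t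
      using ext True by (cases "\<forall>t. L t j0 \<le> c") (auto simp: s_def)
    thus ?thesis by simp
  next
    case False
    have "(\<lambda>t. s j * (c - L t j)) \<midarrow>t0\<rightarrow> s j * (c - L t0 j)"
      by (intro tendsto_intros lim j)
    moreover have "0 < s j * (c - L t0 j)"
      using False ne[OF j False] by (simp add: s_def sgn_if)
    ultimately have "\<forall>\<^sub>F t in at t0. 0 < s j * (c - L t j)" by (rule order_tendstoD)
    thus ?thesis by eventually_elim simp
  qed
  define \<sigma> where "\<sigma> = (\<Prod>j<n. s j)"
  have \<sigma>: "\<sigma> \<noteq> 0" using s0 by (simp add: \<sigma>_def)
  have "\<forall>\<^sub>F t in at t0. \<forall>j\<in>{..<n}. 0 \<le> s j * (c - L t j)"
    using nn by (intro eventually_ball_finite) auto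
  hence "\<forall>\<^sub>F t in at t0. 0 \<le> \<sigma> * (\<Prod>j<n. c - L t j)"
  proof eventually_elim
    case (elim t)
    have "0 \<le> (\<Prod>j<n. s j * (c - L t j))" using elim by (intro prod_nonneg) auto
    thus ?case by (simp add: \<sigma>_def prod.distrib)
  qed
  then obtain e where e: "e > 0" "\<And>t. t \<noteq> t0 \<Longrightarrow> dist t t0 < e \<Longrightarrow> 0 \<le> \<sigma> * (\<Prod>j<n. c - L t j)"
    by (auto simp: eventually_at)
  have z: "(\<Prod>j<n. c - L t0 j) = 0" using j0 eq by (intro prod_zero) auto
  have "\<sigma> * d = 0"
  proof (rule DERIV_local_min[OF DERIV_cmult[OF D] e(1)], intro allI impI)
    fix y assume "\<bar>t0 - y\<bar> < e"
    hence "y = t0 \<or> 0 \<le> \<sigma> * (\<Prod>j<n. c - L y j)"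
      using e(2)[of y] by (simp add: dist_real_def abs_minus_commute) blast
    thus "\<sigma> * (\<Prod>j<n. c - L t0 j) \<le> \<sigma> * (\<Prod>j<n. c - L y j)"
      by (auto simp only: z mult_zero_right)
  qed
  thus ?thesis using \<sigma> by simp
qed

lemma band_eq_eigvals: "band q1 q2 V m k = eigvals (D_V q1 q2 V k) ! (m - 1)"
  by (simp add: band_def eigvals_def)

context period_cell
begin

lemma det_bloch_mat_eigvals:
  "det (bloch_mat V (complex_of_real \<mu>) (cis (2 * pi * t)) (cis (2 * pi * k2))) =
    (- 1) ^ (q1 * q2) * complex_of_real (\<Prod>j<q1 * q2. \<mu> - eigvals (D_V q1 q2 V (t, k2)) ! j)"
  using bloch_mat_D_V[of V "complex_of_real \<mu>" "(t, k2)"]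
    det_minus_smult_one[OF D_V_carrier, of V "(t, k2)" "complex_of_real \<mu>"]
  by (simp add: hermitian_eigvals(3)[OF hermitian_D_V] poly_prod)

lemma signed_det_bloch_mat:
  "(- 1) ^ (q1 * q2) * det (bloch_mat V (complex_of_real \<mu>) (cis (2 * pi * t)) (cis (2 * pi * k2))) =
    complex_of_real (\<Prod>j<q1 * q2. \<mu> - eigvals (D_V q1 q2 V (t, k2)) ! j)"
  by (simp only: det_bloch_mat_eigvals mult.assoc[symmetric] power_mult_distrib[symmetric]
      minus_mult_minus mult_1 power_one)

lemma det_bloch_mat_has_derivative:
  assumes "z0 \<noteq> 0"
  shows "\<exists>D. ((\<lambda>z. det (bloch_mat V l z w)) has_field_derivative D) (at z0)"
  by (rule det_has_derivative_exists[OF bloch_mat_carrier bloch_mat_has_derivative_exists[OF assms]])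

lemma eigvals_D_V_bounded:
  "\<exists>K. \<forall>t. \<forall>j<q1 * q2. \<bar>eigvals (D_V q1 q2 V (t, k2)) ! j\<bar> \<le> K"
proof (intro exI allI impI)
  fix t j assume j: "j < q1 * q2"
  have "\<bar>eigvals (D_V q1 q2 V (t, k2)) ! j\<bar> \<le>
      (\<Sum>i<q1 * q2. \<Sum>j<q1 * q2. norm (D_V q1 q2 V (t, k2) $$ (i, j)))"
    by (rule hermitian_eigvals(4)[OF hermitian_D_V j])
  also have "\<dots> \<le> (\<Sum>i<q1 * q2. \<Sum>j<q1 * q2. \<Sum>d\<in>steps. norm (weight V 0 i d))"
    unfolding D_V_eq_bloch_mat by (intro sum_mono norm_bloch_mat_le) auto
  finally show "\<bar>eigvals (D_V q1 q2 V (t, k2)) ! j\<bar> \<le>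
      (\<Sum>i<q1 * q2. \<Sum>j<q1 * q2. \<Sum>d\<in>steps. norm (weight V 0 i d))" .
qed

text \<open>For every real \<open>\<mu>\<close> the determinant depends continuously on the phase,
  so the characteristic polynomials converge pointwise; boundedness and sortedness then give
  convergence of each eigenvalue.\<close>

lemma eigvals_D_V_tendsto:
  assumes j: "j < q1 * q2"
  shows "(\<lambda>t. eigvals (D_V q1 q2 V (t, k2)) ! j) \<midarrow>t0\<rightarrow> eigvals (D_V q1 q2 V (t0, k2)) ! j"
  unfolding LIMSEQ_SEQ_conv[symmetric]
proof (intro allI impI)
  fix S :: "nat \<Rightarrow> real" assume S: "(\<forall>n. S n \<noteq> t0) \<and> S \<longlonglongrightarrow> t0"
  let ?L = "\<lambda>t j. eigvals (D_V q1 q2 V (t, k2)) ! j" and ?w = "cis (2 * pi * k2)"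
  obtain K where K: "\<And>t j. j < q1 * q2 \<Longrightarrow> \<bar>?L t j\<bar> \<le> K" using eigvals_D_V_bounded by blast
  have sorted: "?L t i \<le> ?L t j" if "i \<le> j" "j < q1 * q2" for t i j
    using hermitian_eigvals(1,2)[OF hermitian_D_V[of V "(t, k2)"]] that
    by (simp add: sorted_iff_nth_mono)
  show "(\<lambda>n. ?L (S n) j) \<longlonglongrightarrow> ?L t0 j"
  proof (rule sorted_roots_LIMSEQ[OF K sorted sorted _ j])
    fix \<mu>
    let ?g = "\<lambda>z. det (bloch_mat V (complex_of_real \<mu>) z ?w)"
    have "isCont ?g (cis (2 * pi * t0))"
      using det_bloch_mat_has_derivative[of "cis (2 * pi * t0)"] DERIV_isCont by fastforce
    moreover have "(\<lambda>n. cis (2 * pi * S n)) \<longlonglongrightarrow> cis (2 * pi * t0)"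
      using S by (auto simp: cis_conv_exp intro!: tendsto_intros)
    ultimately have "(\<lambda>n. ?g (cis (2 * pi * S n))) \<longlonglongrightarrow> ?g (cis (2 * pi * t0))"
      by (rule isCont_tendsto_compose)
    hence "(\<lambda>n. Re ((- 1) ^ (q1 * q2) * ?g (cis (2 * pi * S n)))) \<longlonglongrightarrow>
        Re ((- 1) ^ (q1 * q2) * ?g (cis (2 * pi * t0)))"
      by (intro tendsto_intros)
    moreover have "Re ((- 1) ^ (q1 * q2) * ?g (cis (2 * pi * t))) = (\<Prod>j<q1 * q2. \<mu> - ?L t j)" for t
      by (simp only: signed_det_bloch_mat Re_complex_of_real)
    ultimately show "(\<lambda>n. \<Prod>j<q1 * q2. \<mu> - ?L (S n) j) \<longlonglongrightarrow> (\<Prod>j<q1 * q2. \<mu> - ?L t0 j)"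
      by (simp only:)
  qed auto
qed

lemma det_bloch_mat_stationary:
  assumes m: "1 \<le> m" "m \<le> q1 * q2" and level: "band q1 q2 V m (k1, k2) = c"
    and ext: "(\<forall>t. band q1 q2 V m (t, k2) \<le> c) \<or> (\<forall>t. c \<le> band q1 q2 V m (t, k2))"
  shows "((\<lambda>z. det (bloch_mat V (complex_of_real c) z (cis (2 * pi * k2)))) has_field_derivative 0)
    (at (cis (2 * pi * k1)))"
proof -
  let ?n = "q1 * q2" and ?z0 = "cis (2 * pi * k1)" and ?w = "cis (2 * pi * k2)"
  let ?L = "\<lambda>t j. eigvals (D_V q1 q2 V (t, k2)) ! j"
  let ?A = "D_V q1 q2 V (k1, k2)" and ?c = "complex_of_real c"
  let ?g = "\<lambda>z. det (bloch_mat V ?c z ?w)"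
  have mn: "m - 1 < ?n" using m by simp
  have Lc: "?L k1 (m - 1) = c" using level by (simp add: band_eq_eigvals)
  have g0: "?g ?z0 = 0"
    unfolding det_bloch_mat_eigvals using mn Lc by (auto intro!: bexI[of _ "m - 1"])
  obtain D where D: "(?g has_field_derivative D) (at ?z0)"
    using det_bloch_mat_has_derivative[OF cis_neq_zero] by blast
  show ?thesis
  proof (cases "poly (pderiv (char_poly ?A)) ?c = 0")
    case True
    let ?B = "bloch_mat V ?c ?z0 ?w"
    \<comment> \<open>Adding \<open>x\<close> times the identity lowers the spectral parameter by
      \<open>x\<close>, so a multiple root of the characteristic polynomial is exactly a vanishing
      derivative in the direction of the identity.\<close>
    have "det (?B + x \<cdot>\<^sub>m 1\<^sub>m ?n) = (- 1) ^ ?n * poly (char_poly ?A) (?c - x)" for x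
    proof -
      have "?B + x \<cdot>\<^sub>m 1\<^sub>m ?n = ?A - (?c - x) \<cdot>\<^sub>m 1\<^sub>m ?n"
        using bloch_mat_D_V[of V ?c "(k1, k2)"] D_V_carrier[of V "(k1, k2)"]
        by (auto intro!: eq_matI)
      thus ?thesis by (simp add: det_minus_smult_one[OF D_V_carrier])
    qed
    moreover have "((\<lambda>x. (- 1) ^ ?n * poly (char_poly ?A) (?c - x)) has_field_derivative
        (- 1) ^ ?n * (poly (pderiv (char_poly ?A)) (?c - 0) * (0 - 1))) (at 0)"
      by (intro DERIV_cmult DERIV_chain2[OF poly_DERIV] DERIV_diff DERIV_const DERIV_ident)
    ultimately have "((\<lambda>x. det (?B + x \<cdot>\<^sub>m 1\<^sub>m ?n)) has_field_derivative 0) (at 0)"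
      using True by simp
    thus ?thesis
      using g0 by (intro det_perturbation_multiple_eigenvalue[OF hermitian_bloch_mat _ _ bloch_mat_carrier])
        (auto intro!: bloch_mat_has_derivative_exists)
  next
    case False
    let ?P = "\<lambda>t. \<Prod>j<?n. c - ?L t j"
    \<comment> \<open>A second eigenvalue equal to \<open>c\<close> would make the derivative of the
      characteristic polynomial vanish.\<close>
    have ne: "?L k1 j \<noteq> c" if "j < ?n" "j \<noteq> m - 1" for j
      using poly_pderiv_prod_multiple_root[of j ?n "m - 1" "\<lambda>j. complex_of_real (?L k1 j)" ?c]
        that mn Lc False by (auto simp: hermitian_eigvals(3)[OF hermitian_D_V, symmetric])
    \<comment> \<open>By the chain rule, \<open>b\<close> is the derivative at \<open>k1\<close> of
      the signed determinant along the unit circle. It is \<open>D\<close> times a nonzero factor,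
      so \<open>b = 0\<close> suffices.\<close>
    define b where "b = (- 1) ^ ?n * (D * (\<i> * ?z0 * of_real (2 * pi)))"
    have "((\<lambda>t::real. cis (2 * pi * t)) has_derivative (\<lambda>x. (2 * pi * x) *\<^sub>R (\<i> * ?z0))) (at k1)"
      by (auto intro!: derivative_eq_intros)
    moreover have "(?g has_derivative (*) D) (at ?z0)"
      using D by (simp add: has_field_derivative_def)
    ultimately have "((\<lambda>t. ?g (cis (2 * pi * t))) has_derivative
        (\<lambda>x. D * ((2 * pi * x) *\<^sub>R (\<i> * ?z0)))) (at k1)"
      by (rule has_derivative_compose)
    hence "((\<lambda>t. (- 1) ^ ?n * ?g (cis (2 * pi * t))) has_derivative
        (\<lambda>x. (- 1) ^ ?n * (D * ((2 * pi * x) *\<^sub>R (\<i> * ?z0))))) (at k1)"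
      by (rule has_derivative_mult_right)
    moreover have "(- 1) ^ ?n * ?g (cis (2 * pi * t)) = complex_of_real (?P t)" for t
      by (rule signed_det_bloch_mat)
    moreover have "(- 1) ^ ?n * (D * ((2 * pi * x) *\<^sub>R (\<i> * ?z0))) = b * of_real x" for x
      by (simp add: b_def scaleR_conv_of_real mult_ac)
    ultimately have P: "((\<lambda>t. complex_of_real (?P t)) has_derivative (\<lambda>x. b * of_real x)) (at k1)"
      by (simp only:)
    \<comment> \<open>The signed determinant is real along the circle: the real part of
      \<open>b\<close> vanishes by extremality, the imaginary part because it is the derivative of
      the zero function.\<close>
    have parts: "Re (b * of_real x) = Re b * x" "Im (b * of_real x) = Im b * x" for x by simp_all
    have "((\<lambda>t. Re (complex_of_real (?P t))) has_derivative (\<lambda>x. Re (b * of_real x))) (at k1)"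
      by (rule has_derivative_Re[OF P])
    hence P': "(?P has_field_derivative Re b) (at k1)"
      by (simp only: has_field_derivative_def Re_complex_of_real parts)
    have Re: "Re b = 0"
    proof (rule root_product_stationary[OF _ mn _ Lc ext[unfolded band_eq_eigvals] P'])
      show "(\<lambda>t. ?L t j) \<midarrow>k1\<rightarrow> ?L k1 j" if "j < ?n" for j by (rule eigvals_D_V_tendsto[OF that])
      show "?L k1 j \<noteq> c" if "j < ?n" "j \<noteq> m - 1" for j by (rule ne[OF that])
    qed
    have "((\<lambda>t. Im (complex_of_real (?P t))) has_derivative (\<lambda>x. Im (b * of_real x))) (at k1)"
      by (rule has_derivative_Im[OF P])
    hence "((\<lambda>t::real. 0::real) has_field_derivative Im b) (at k1)"
      by (simp only: has_field_derivative_def Im_complex_of_real parts)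
    hence "Im b = 0" using DERIV_unique[OF _ DERIV_const] by blast
    with Re have "b = 0" by (simp add: complex_eq_iff)
    hence "D = 0" by (simp add: b_def)
    with D show ?thesis by simp
  qed
qed

lemma level_point_double_root:
  assumes m: "1 \<le> m" "m \<le> q1 * q2" and level: "band q1 q2 V m (k1, k2) = c"
    and ext: "(\<forall>t. band q1 q2 V m (t, k2) \<le> c) \<or> (\<forall>t. c \<le> band q1 q2 V m (t, k2))"
  defines "p \<equiv> eval_coeffs (cis (2 * pi * k2)) (bloch_poly V (complex_of_real c))"
  shows "poly p (cis (2 * pi * k1)) = 0 \<and> poly (pderiv p) (cis (2 * pi * k1)) = 0"
proof
  let ?z0 = "cis (2 * pi * k1)" and ?w = "cis (2 * pi * k2)"
  let ?g = "\<lambda>z. det (bloch_mat V (complex_of_real c) z ?w)"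
  have g0: "?g ?z0 = 0"
    unfolding det_bloch_mat_eigvals using m level
    by (auto simp: band_eq_eigvals intro!: bexI[of _ "m - 1"])
  have pg: "poly p z = z ^ q2 * ?w ^ q1 * ?g z" if "z \<noteq> 0" for z
    using poly_bloch_poly[OF that, of ?w V "complex_of_real c"] by (simp add: p_def)
  show "poly p ?z0 = 0" using pg[of ?z0] g0 by simp
  have g': "(?g has_field_derivative 0) (at ?z0)"
    by (rule det_bloch_mat_stationary[OF m level ext])
  have "((\<lambda>z. z ^ q2 * ?w ^ q1 * ?g z) has_field_derivative 0) (at ?z0)"
    using g' g0 by (auto intro!: derivative_eq_intros)
  \<comment> \<open>The factorisation holds only away from 0, so derivatives are compared on a
    neighbourhood of the unimodular point.\<close>
  moreover have "\<forall>\<^sub>F z in nhds ?z0. poly p z = z ^ q2 * ?w ^ q1 * ?g z"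
  proof -
    have "\<forall>\<^sub>F z in nhds ?z0. z \<in> - {0}" by (rule eventually_nhds_in_open) auto
    thus ?thesis by eventually_elim (simp add: pg)
  qed
  ultimately have "(poly p has_field_derivative 0) (at ?z0)"
    by (subst DERIV_cong_ev[OF refl _ refl])
  thus "poly (pderiv p) ?z0 = 0" using DERIV_unique poly_DERIV by blast
qed

text \<open>Periodicity extends the extremality from the half-open interval to all real
  \<open>t\<close>, so that the two-sided extremum test also applies at the endpoint 0.\<close>

lemma band_frac: "band q1 q2 V m (frac t, k2) = band q1 q2 V m (t, k2)"
proof -
  have "cis (2 * pi * t) = cis (2 * pi * frac t) * cis (2 * pi * of_int \<lfloor>t\<rfloor>)"
    by (simp only: cis_mult) (simp add: frac_def algebra_simps)
  hence "cis (2 * pi * frac t) = cis (2 * pi * t)" by (simp add: cis_multiple_2pi)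
  hence "D_V q1 q2 V (frac t, k2) = D_V q1 q2 V (t, k2)" by (simp add: D_V_eq_bloch_mat)
  thus ?thesis by (simp add: band_eq_eigvals)
qed

end

section \<open>Counting the level set\<close>

lemma inj_on_cis_unit_interval: "inj_on (\<lambda>t. cis (2 * pi * t)) {0..<1}"
proof (rule inj_onI)
  fix a b :: real assume ab: "a \<in> {0..<1}" "b \<in> {0..<1}" and e: "cis (2 * pi * a) = cis (2 * pi * b)"
  have "cis (2 * pi * a - 2 * pi * b) = 1" using e by (simp flip: cis_divide)
  hence "cos (2 * pi * a - 2 * pi * b) = 1" by (simp add: complex_eq_iff)
  then obtain n :: int where "2 * pi * a - 2 * pi * b = of_int n * 2 * pi" using cos_one_2pi_int by auto
  hence "2 * pi * (a - b) = 2 * pi * of_int n" by (simp add: algebra_simps)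
  hence n: "a - b = of_int n" by simp
  have "-1 < a - b" "a - b < 1" using ab by auto
  hence "n = 0" unfolding n by linarith
  thus "a = b" using n by simp
qed

theorem theorem3p1:
  fixes q1 q2 m :: nat and V :: "int \<times> int \<Rightarrow> real" and lstar :: real
  assumes "q1 > 0" and "q2 > 0" and "coprime q1 q2"
    and "periodic2 q1 q2 V"
    and "m \<in> {1..q1 * q2}"
    and "lstar \<in> band q1 q2 V m ` ({0..<1} \<times> {0..<1})"
    and "(\<forall>k \<in> {0..<1} \<times> {0..<1}. band q1 q2 V m k \<le> lstar) \<or>
         (\<forall>k \<in> {0..<1} \<times> {0..<1}. lstar \<le> band q1 q2 V m k)"
  shows "finite {k \<in> {0..<1} \<times> {0..<1}. band q1 q2 V m k = lstar} \<and>
         card {k \<in> {0..<1} \<times> {0..<1}. band q1 q2 V m k = lstar} \<le> 9 * q1 * q2 - 3"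
proof -
  interpret period_cell q1 q2 using assms by unfold_locales
  let ?S = "{k \<in> {0..<1} \<times> {0..<1}. band q1 q2 V m k = lstar}"
  let ?p = "\<lambda>w. eval_coeffs w (bloch_poly V (complex_of_real lstar))"
  let ?T = "{(z, w). w \<noteq> 0 \<and> poly (?p w) z = 0 \<and> poly (pderiv (?p w)) z = 0}"
  let ?h = "\<lambda>k. (cis (2 * pi * fst k), cis (2 * pi * snd k))"
  \<comment> \<open>On the half-open square a quasimomentum is determined by its phases, so the
    count of double roots transfers to level points.\<close>
  have inj: "inj_on ?h ?S"
    using inj_on_cis_unit_interval by (force simp: inj_on_def)
  have sub: "?h ` ?S \<subseteq> ?T"
  proof
    fix x assume "x \<in> ?h ` ?S"
    then obtain k1 k2 where k: "k1 \<in> {0..<1}" "k2 \<in> {0..<1}" "band q1 q2 V m (k1, k2) = lstar"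
      and x: "x = (cis (2 * pi * k1), cis (2 * pi * k2))" by auto
    have "frac t \<in> {0..<1}" for t :: real by (simp add: frac_lt_1)
    hence "(\<forall>t. band q1 q2 V m (frac t, k2) \<le> lstar) \<or> (\<forall>t. lstar \<le> band q1 q2 V m (frac t, k2))"
      using assms(7) k(2) by blast
    hence "(\<forall>t. band q1 q2 V m (t, k2) \<le> lstar) \<or> (\<forall>t. lstar \<le> band q1 q2 V m (t, k2))"
      by (simp only: band_frac)
    from level_point_double_root[OF _ _ k(3) this] show "x \<in> ?T"
      using assms(5) by (simp add: x)
  qed
  have T: "finite ?T" "card ?T \<le> 2 * q1 * (2 * (2 * q2) - 1)"
    using card_double_roots_bloch_poly by blast+
  have "finite ?S" using finite_subset[OF sub T(1)] inj by (rule finite_imageD)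
  moreover have "card ?S \<le> 9 * q1 * q2 - 3"
  proof -
    have "card ?S \<le> card ?T" by (rule card_inj_on_le[OF inj sub T(1)])
    also note T(2)
    \<comment> \<open>The left side is \<open>8 * (q1 * q2) - 2 * q1\<close>, and the gap
      \<open>q1 * q2 + 2 * q1 - 3\<close> is nonnegative for positive periods.\<close>
    also have "2 * q1 * (2 * (2 * q2) - 1) \<le> 9 * q1 * q2 - 3"
    proof -
      have "2 * q1 * (2 * (2 * q2) - 1) = 8 * (q1 * q2) - 2 * q1" by (simp add: diff_mult_distrib2)
      moreover have "1 \<le> q1 * q2" using assms(1,2) by simp
      ultimately show ?thesis using assms(1) by (simp add: mult.assoc)
    qed
    finally show ?thesis .
  qed
  ultimately show ?thesis by blast
qed

end
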